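(* Let $T:(0,1]\to(0,1]$ be defined by $Tx=2^n x-1$ for $x\in(2^{-n},2^{-n+1}]$, $n\in\mathbb{N}$, and $d_1(x)=\lceil-\log_2 x\rceil$. Let $\varphi(x)=\log(d_1(x))$ and for $\xi\in\mathbb{R}$ let $E_\varphi(\xi)=\{x\in(0,1]:\lim_{n\to\infty}\frac1n\sum_{j=0}^{n-1}\varphi(T^jx)=\xi\}$. Let $P(t,q)$ be the pressure function $$P(t,q)=\lim_{n\to\infty}\frac1n\log\sum_{\omega_1,\dots,\omega_n\in\mathbb{N}}\exp\Big(\sup_{x:\,d_1(T^{i-1}x)=\omega_i,\,1\le i\le n}\sum_{j=0}^{n-1}\big(-t\log|T'(T^jx)|+q\varphi(T^jx)\big)\Big).$$ Then $P(t,q)=\log\big(\sum_{n=1}^\infty 2^{-nt}n^q\big)$, and for every $\xi>0$ the system $$P(t,q)=q\xi,\qquad \frac{\partial P}{\partial q}(t,q)=\xi$$ has a unique solution $(t(\xi),q(\xi))$. Moreover $\dim_H E_\varphi(0)=0$ and $\dim_H E_\varphi(\xi)=t(\xi)$ for every $\xi>0$. Let $\xi_0=\int_0^1\log\lceil-\log_2x\rceil\,dx$. Then: (1) $t(\xi_0)=1$; (2) $t'(\xi)>0$ for $0<\xi<\xi_0$, $t'(\xi_0)=0$, and $t'(\xi)<0$ for $\xi>\xi_0$; (3) $\lim_{\xi\to0}t(\xi)=0$ and $\lim_{\xi\to\infty}t(\xi)=0$; (4) $\lim_{\xi\to0}t'(\xi)=\infty$; (5) $t''(\xi_0)<0$ and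 there exists $\xi_1>\xi_0$ with $t''(\xi_1)>0$; in particular $t$ is neither convex nor concave.
   Context: $T'(x)=2^n$ on $(2^{-n},2^{-n+1}]$. The pressure $P$ is considered on the set of $(t,q)$ where the defining series converges. $\dim_H$ is Hausdorff dimension, $\dim_H\emptyset=0$.
   Formalization: d_1(x) is taken as the n with x in (2^{-n},2^{-n+1}], i.e. floor(-log_2 x)+1, instead of ceil(-log_2 x), which gives d_1(1)=0 and phi(1)=log 0; the two differ only at the points 2^{-k}, which changes E_phi only on a countable set. *)

theory Defs
  imports "HOL-Analysis.Analysis"
begin

definition hausdorff_approx :: "real \<Rightarrow> real \<Rightarrow> real set \<Rightarrow> ennreal" where
  "hausdorff_approx s \<delta> E =
     (INF U \<in> {U :: nat \<Rightarrow> real set. E \<subseteq> (\<Union>i. U i) \<and>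
                 (\<forall>i. bounded (U i) \<and> diameter (U i) \<le> \<delta>)}.
        (\<Sum>i. ennreal (diameter (U i) powr s)))"

definition hausdorff_measure :: "real \<Rightarrow> real set \<Rightarrow> ennreal" where
  "hausdorff_measure s E = (SUP \<delta> \<in> {0<..}. hausdorff_approx s \<delta> E)"

text \<open>dim_H E = inf { s > 0 . H^s(E) = 0 }; this gives dim_H {} = 0.\<close>
definition hausdorff_dim :: "real set \<Rightarrow> real" where
  "hausdorff_dim E = Inf {s. s > 0 \<and> hausdorff_measure s E = 0}"

text \<open>d1 x = n  iff  x \<in> (2^-n, 2^(-n+1)], n \<ge> 1 (equals ceiling(-log2 x) off dyadic points).\<close>
definition d1 :: "real \<Rightarrow> nat" where
  "d1 x = nat \<lfloor>- log 2 x\<rfloor> + 1"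

definition T :: "real \<Rightarrow> real" where
  "T x = 2 ^ d1 x * x - 1"

definition Tderiv :: "real \<Rightarrow> real" where
  "Tderiv x = 2 ^ d1 x"

definition phi :: "real \<Rightarrow> real" where
  "phi x = ln (real (d1 x))"

definition E_phi :: "real \<Rightarrow> real set" where
  "E_phi \<xi> = {x \<in> {0<..1}. (\<lambda>n. (\<Sum>j<n. phi ((T ^^ j) x)) / real n) \<longlonglongrightarrow> \<xi>}"

definition words :: "nat \<Rightarrow> nat list set" where
  "words n = {\<omega>. length \<omega> = n \<and> (\<forall>k\<in>set \<omega>. 1 \<le> k)}"

definition pressure_term :: "nat \<Rightarrow> real \<Rightarrow> real \<Rightarrow> nat list \<Rightarrow> real" where
  "pressure_term n t q \<omega> =
     exp (Sup {(\<Sum>j<n. - t * ln \<bar>Tderiv ((T ^^ j) x)\<bar> + q * phi ((T ^^ j) x)) | x.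
                 x \<in> {0<..1} \<and> (\<forall>j<n. d1 ((T ^^ j) x) = \<omega> ! j)})"

definition partition_sum :: "nat \<Rightarrow> real \<Rightarrow> real \<Rightarrow> real" where
  "partition_sum n t q = infsum (pressure_term n t q) (words n)"

definition pressure_domain :: "(real \<times> real) set" where
  "pressure_domain = {(t, q). \<forall>n\<ge>1. pressure_term n t q summable_on words n}"

definition pressure :: "real \<Rightarrow> real \<Rightarrow> real" where
  "pressure t q = lim (\<lambda>n. ln (partition_sum n t q) / real n)"

definition solves_system :: "real \<Rightarrow> real \<times> real \<Rightarrow> bool" where
  "solves_system \<xi> p \<longleftrightarrow> p \<in> pressure_domain \<and>
     pressure (fst p) (snd p) = snd p * \<xi> \<and>
     ((\<lambda>q'. pressure (fst p) q') has_real_derivative \<xi>) (at (snd p))"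

definition t_of :: "real \<Rightarrow> real" where
  "t_of \<xi> = fst (THE p. solves_system \<xi> p)"

definition xi0 :: real where
  "xi0 = integral {0..1} (\<lambda>x. ln (real_of_int \<lceil>- log 2 x\<rceil>))"

end

theory Submission
  imports Defs "HOL-Probability.Probability" "HOL-Real_Asymp.Real_Asymp"
begin

text \<open>
  All branches of \<open>T\<close> are full and affine, so every exponential sum over words factorises and the pressure
  is the logarithm of a single series. Since the pressure is strictly convex in \<open>q\<close> and strictly
  decreasing in \<open>t\<close>, the Legendre-type map \<open>(t, q) \<mapsto> (\<partial>\<^sub>q P, P - q \<partial>\<^sub>q P)\<close> is injective with Jacobian
  \<open>- \<partial>\<^sub>q\<^sub>q P \<partial>\<^sub>t P > 0\<close>; the inverse function theorem makes \<open>t(\<xi>), q(\<xi>)\<close> differentiable with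
  \<open>t' = q / \<partial>\<^sub>t P\<close>, and the qualitative claims reduce to the sign and the growth of \<open>q(\<xi>)\<close>.

  The upper bound for the dimension comes from covering by cylinders whose digit average is close to \<open>\<xi>\<close>.
  For the lower bound, the Bernoulli measure with weights \<open>2\<^bsup>-kt\<^esup> k\<^bsup>q\<^esup> e\<^bsup>-q\<xi>\<^esup>\<close> is concentrated on sequences coding
  points of \<open>E_phi \<xi>\<close> (Chernoff bound and Borel-Cantelli), and the mass distribution principle is applied to
  dyadic intervals: such an interval fixes finitely many digits and bounds the next one from below.
\<close>


subsection \<open>The weighted series\<close>

text \<open>The alphabet is infinite, and this shapes the proof twice. The series converges for
  every q when t > 0, but also at t = 0 for q < -1, so solutions on that boundary have to be
  excluded separately. In the lower bound, a dyadic interval next to an endpoint contains infinitely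
  many cylinders of the next generation without being a single cylinder; the mass of all digits
  beyond r has to be compared with 2^(-r s). The room for this is the gap t - s > 0, which also
  absorbs the fluctuation of the digit average. Existence of a solution comes from a minimax
  picture: t is a zero of the function sending t to the minimum over q of P(t, q) - q \<xi>. It is
  at most 0 at t = 1, because P(1, 0) = 0 (the weights 2^-k are the branch lengths and sum to 1),
  and at least 0 for small t. A point with t'' > 0 is found indirectly: otherwise t' would stay
  below a negative constant beyond \<xi>0 and t would leave (0, 1].\<close>

text \<open>Index \<open>k\<close> stands for the digit \<open>Suc k\<close>.\<close>

definition weight :: "real \<Rightarrow> real \<Rightarrow> nat \<Rightarrow> real" where
  "weight t q k = 2 powr (- real (Suc k) * t) * real (Suc k) powr q"

text \<open>The \<open>b\<close>-th derivative in \<open>q\<close> of the partition function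
  \<open>wsum 0\<close>, or the unnormalised \<open>b\<close>-th moment of the logarithm of the
  digit.\<close>

definition wsum :: "nat \<Rightarrow> real \<Rightarrow> real \<Rightarrow> real" where
  "wsum b t q = (\<Sum>k. ln (real (Suc k)) ^ b * weight t q k)"

lemma weight_pos: "weight t q k > 0"
  by (simp add: weight_def)

lemma weight_0 [simp]: "weight t q 0 = 2 powr - t"
  by (simp add: weight_def)

lemma weight_eq_exp: "weight t q k = exp (q * ln (real (Suc k)) - real (Suc k) * t * ln 2)"
  by (simp add: weight_def powr_def exp_add[symmetric] exp_diff algebra_simps del: of_nat_Suc)

lemma weight_add: "weight t (q + r) k = weight t q k * exp (r * ln (real (Suc k)))"
  unfolding weight_eq_exp by (simp add: exp_add[symmetric] algebra_simps del: of_nat_Suc)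

lemma weight_Suc_q: "weight t (q + 1) k = real (Suc k) * weight t q k"
  by (simp add: weight_add del: of_nat_Suc)

lemma weight_mono_q: "q \<le> q' \<Longrightarrow> weight t q k \<le> weight t q' k"
  unfolding weight_eq_exp by (auto intro!: mult_right_mono)

lemma weight_antimono_t: "t \<le> t' \<Longrightarrow> weight t' q k \<le> weight t q k"
  unfolding weight_eq_exp by (auto intro!: mult_right_mono mult_left_mono)

lemma summable_weight:
  assumes "t > 0"
  shows "summable (\<lambda>k. ln (real (Suc k)) ^ b * weight t q k)"
proof (rule summable_comparison_test_bigo[where g = "\<lambda>k. 1 / real (Suc k) ^ 2"])
  show "summable (\<lambda>k. norm (1 / real (Suc k) ^ 2))"
    using inverse_power_summable[of 2, where 'a = real] summable_Suc_iff[of "\<lambda>n. inverse (real n ^ 2)"]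
    by (simp add: inverse_eq_divide)
  show "(\<lambda>k. ln (real (Suc k)) ^ b * weight t q k) \<in> O(\<lambda>k. 1 / real (Suc k) ^ 2)"
    using assms unfolding weight_def by real_asymp
qed

lemma summable_weight0: "t > 0 \<Longrightarrow> summable (weight t q)"
  using summable_weight[of t 0 q] by simp

lemma wsum_0_eq: "wsum 0 t q = (\<Sum>k. weight t q k)"
  by (simp add: wsum_def)

text \<open>Differentiating in \<open>t\<close> multiplies the weight of the digit \<open>n\<close> by \<open>- n ln 2\<close>, which amounts to the shift \<open>q + 1\<close>.\<close>

lemma wsum_has_derivative:
  assumes "t > 0"
  shows "((\<lambda>p. wsum b (fst p) (snd p)) has_derivative
          (\<lambda>h. - ln 2 * wsum b t (q + 1) * fst h + wsum (Suc b) t q * snd h)) (at (t, q))"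
proof -
  \<comment> \<open>On this box every weight is dominated by its value at the corner
    \<open>(t/2, q + 1)\<close>, since weights decrease in \<open>t\<close> and increase in
    \<open>q\<close>. This yields majorants for the M-test that are summable because
    \<open>t/2 > 0\<close>.\<close>
  define S :: "(real \<times> real) set" where "S = {t/2<..} \<times> {..<q + 1}"
  have conv: "convex S" unfolding S_def by (intro convex_Times convex_real_interval)
  have opS: "open S" unfolding S_def by (intro open_Times) auto
  have inS: "(t, q) \<in> S" using assms by (auto simp: S_def)
  define f where "f = (\<lambda>k p. ln (real (Suc k)) ^ b * weight (fst p) (snd p) k)"
  define f' where "f' = (\<lambda>k p h. - ln 2 * (ln (real (Suc k)) ^ b * weight (fst p) (snd p + 1) k) * fst h
      + (ln (real (Suc k)) ^ Suc b * weight (fst p) (snd p) k) * snd (h :: real \<times> real))"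
  define g' where "g' = (\<lambda>p h. - ln 2 * wsum b (fst p) (snd p + 1) * fst h
      + wsum (Suc b) (fst p) (snd p) * snd (h :: real \<times> real))"
  have lnle: "0 \<le> ln (real (Suc k)) " for k by simp
  have der: "(f k has_derivative f' k p) (at p within S)" for k p
    unfolding f_def f'_def weight_Suc_q unfolding weight_eq_exp
    by (auto intro!: derivative_eq_intros simp: algebra_simps simp del: of_nat_Suc)
  define M1 where "M1 = (\<lambda>k. ln (real (Suc k)) ^ b * weight (t/2) (q + 1 + 1) k)"
  define M2 where "M2 = (\<lambda>k. ln (real (Suc k)) ^ Suc b * weight (t/2) (q + 1) k)"
  have wle: "weight (fst p) (snd p + r) k \<le> weight (t/2) (q + 1 + r) k" if "p \<in> S" for p k r
    using that by (auto simp: S_def intro!: order.trans[OF weight_antimono_t weight_mono_q])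
  have u1: "uniform_limit S (\<lambda>n p. \<Sum>k<n. ln (real (Suc k)) ^ b * weight (fst p) (snd p + 1) k)
      (\<lambda>p. wsum b (fst p) (snd p + 1)) sequentially"
    unfolding wsum_def
  proof (rule Weierstrass_m_test[where M = M1])
    show "summable M1" unfolding M1_def using assms by (intro summable_weight) auto
  next
    fix k p assume p: "p \<in> S"
    show "norm (ln (real (Suc k)) ^ b * weight (fst p) (snd p + 1) k) \<le> M1 k"
      using wle[OF p, of 1 k] weight_pos[of "fst p" "snd p + 1" k] lnle[of k]
      unfolding M1_def by (simp add: mult_left_mono abs_mult del: of_nat_Suc)
  qed
  have u2: "uniform_limit S (\<lambda>n p. \<Sum>k<n. ln (real (Suc k)) ^ Suc b * weight (fst p) (snd p) k)
      (\<lambda>p. wsum (Suc b) (fst p) (snd p)) sequentially"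
    unfolding wsum_def
  proof (rule Weierstrass_m_test[where M = M2])
    show "summable M2" unfolding M2_def using assms by (intro summable_weight) auto
  next
    fix k p assume p: "p \<in> S"
    have "ln (real (Suc k)) ^ Suc b * weight (fst p) (snd p) k \<le> ln (real (Suc k)) ^ Suc b * weight (t/2) (q + 1) k"
      using wle[OF p, of 0 k] lnle[of k] by (intro mult_left_mono zero_le_power) auto
    moreover have "0 \<le> ln (real (Suc k)) ^ Suc b * weight (fst p) (snd p) k"
      using weight_pos[of "fst p" "snd p" k] lnle[of k] by (intro mult_nonneg_nonneg zero_le_power) auto
    ultimately show "norm (ln (real (Suc k)) ^ Suc b * weight (fst p) (snd p) k) \<le> M2 k"
      unfolding M2_def by simp
  qed
  have ev: "\<forall>\<^sub>F n in sequentially. \<forall>x\<in>S. \<forall>h. norm (sum (\<lambda>i. f' i x h) {..<n} - g' x h) \<le> e * norm h"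
    if "e > 0" for e
  proof -
    have e2: "e / 2 > 0" using that by simp
    from uniform_limitD[OF u1 e2] uniform_limitD[OF u2 e2] show ?thesis
    proof eventually_elim
      case (elim n)
      show ?case
      proof (intro ballI allI)
        fix x h assume x: "x \<in> S"
        let ?A = "(\<Sum>k<n. ln (real (Suc k)) ^ b * weight (fst x) (snd x + 1) k) - wsum b (fst x) (snd x + 1)"
        let ?B = "(\<Sum>k<n. ln (real (Suc k)) ^ Suc b * weight (fst x) (snd x) k) - wsum (Suc b) (fst x) (snd x)"
        have A: "\<bar>?A\<bar> \<le> e / 2" and B: "\<bar>?B\<bar> \<le> e / 2"
          using elim x by (auto simp: dist_real_def simp del: of_nat_Suc power_Suc intro!: less_imp_le)
        have eq: "sum (\<lambda>i. f' i x h) {..<n} - g' x h = - ln 2 * ?A * fst h + ?B * snd h"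
          unfolding f'_def g'_def
          by (simp only: sum.distrib sum_distrib_left[symmetric] sum_distrib_right[symmetric])
            (simp add: algebra_simps del: of_nat_Suc power_Suc)
        have "\<bar>- ln 2 * ?A * fst h\<bar> \<le> 1 * (e/2) * norm h"
          unfolding abs_mult using A ln_2_less_1 norm_fst_le[of "fst h" "snd h"] that
          by (intro mult_mono) auto
        moreover have "\<bar>?B * snd h\<bar> \<le> (e/2) * norm h"
          unfolding abs_mult using B norm_snd_le[of "snd h" "fst h"] that
          by (intro mult_mono) auto
        ultimately have "\<bar>- ln 2 * ?A * fst h + ?B * snd h\<bar> \<le> (e/2) * norm h + (e/2) * norm h"
          by linarith
        then show "norm (sum (\<lambda>i. f' i x h) {..<n} - g' x h) \<le> e * norm h"
          unfolding eq by simp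
      qed
    qed
  qed
  have sm: "(\<lambda>n. f n (t, q)) sums wsum b t q"
    unfolding f_def wsum_def using summable_weight[OF assms] by (simp add: summable_sums)
  obtain g where g: "\<And>x. x \<in> S \<Longrightarrow> (\<lambda>n. f n x) sums g x"
      "\<And>x. x \<in> S \<Longrightarrow> (g has_derivative g' x) (at x within S)"
    using has_derivative_series[OF conv der ev inS sm] by blast
  have geq: "g x = wsum b (fst x) (snd x)" if "x \<in> S" for x
    using sums_unique[OF g(1)[OF that]] by (simp add: f_def wsum_def)
  have "(g has_derivative g' (t, q)) (at (t, q))"
    using g(2)[OF inS] at_within_open[OF inS opS] by simp
  then have "((\<lambda>p. wsum b (fst p) (snd p)) has_derivative g' (t, q)) (at (t, q))"
    by (rule has_derivative_transform_within_open[OF _ opS inS]) (use geq in auto)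
  then show ?thesis by (simp add: g'_def)
qed

lemma wsum_deriv_q:
  assumes "t > 0"
  shows "((\<lambda>q. wsum b t q) has_real_derivative wsum (Suc b) t q) (at q)"
proof -
  have "((\<lambda>q. (t, q)) has_derivative (\<lambda>h. (0, h))) (at q)"
    by (auto intro!: derivative_eq_intros)
  from diff_chain_at[OF this wsum_has_derivative[OF assms, of b]]
  show ?thesis by (simp add: o_def has_field_derivative_def)
qed

lemma wsum_ge: "t > 0 \<Longrightarrow> weight t q k \<le> wsum 0 t q"
  unfolding wsum_0_eq using sum_le_suminf[OF summable_weight0, of t "{k}" q]
  by (simp add: weight_pos less_imp_le)

lemma wsum_ge_sum: "t > 0 \<Longrightarrow> sum (weight t q) {..<n} \<le> wsum 0 t q"
  unfolding wsum_0_eq using sum_le_suminf[OF summable_weight0, of t "{..<n}" q]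
  by (simp add: weight_pos less_imp_le)

lemma wsum0_pos: "t > 0 \<Longrightarrow> wsum 0 t q > 0"
  using wsum_ge[of t q 0] weight_pos[of t q 0] by linarith

lemma wsum_Suc_pos: 
  assumes "t > 0" shows "wsum (Suc b) t q > 0"
proof -
  \<comment> \<open>Index 0 contributes nothing because \<open>ln 1 = 0\<close>; index 1, the digit
    2, gives the first positive term.\<close>
  have "ln (real (Suc 1)) ^ Suc b * weight t q 1 \<le> wsum (Suc b) t q"
    unfolding wsum_def using sum_le_suminf[OF summable_weight[OF assms, of "Suc b" q], of "{1}"]
    by (simp add: weight_pos less_imp_le)
  moreover have "0 < ln (real (Suc 1)) ^ Suc b * weight t q 1"
    by (intro mult_pos_pos weight_pos zero_less_power) auto
  ultimately show ?thesis by linarith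
qed

section \<open>The pressure function, its partial derivatives and its convexity\<close>

definition press :: "real \<Rightarrow> real \<Rightarrow> real" where
  "press t q = ln (wsum 0 t q)"

text \<open>Under the probability weights \<open>weight t q k / wsum 0 t q\<close>, this and the
  next three quantities are the mean and the variance of the logarithm of the digit, the mean of ln
  |T'| (the Lyapunov exponent), and the covariance of the two. For P = \<open>press\<close> they
  equal the derivatives P_q, P_qq, - P_t and - P_tq.\<close>

definition lnmean :: "real \<Rightarrow> real \<Rightarrow> real" where
  "lnmean t q = wsum 1 t q / wsum 0 t q"

definition lnvar :: "real \<Rightarrow> real \<Rightarrow> real" where
  "lnvar t q = wsum 2 t q / wsum 0 t q - (lnmean t q)\<^sup>2"

definition lyap :: "real \<Rightarrow> real \<Rightarrow> real" where
  "lyap t q = ln 2 * wsum 0 t (q + 1) / wsum 0 t q"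

definition lncov :: "real \<Rightarrow> real \<Rightarrow> real" where
  "lncov t q = ln 2 * wsum 1 t (q + 1) / wsum 0 t q - lnmean t q * lyap t q"

lemma lnmean_pos: "t > 0 \<Longrightarrow> lnmean t q > 0"
  unfolding lnmean_def using wsum_Suc_pos[of t 0] wsum0_pos by simp

lemma lyap_pos: "t > 0 \<Longrightarrow> lyap t q > 0"
  unfolding lyap_def using wsum0_pos by simp

lemma press_has_derivative:
  assumes "t > 0"
  shows "((\<lambda>p. press (fst p) (snd p)) has_derivative
          (\<lambda>h. - lyap t q * fst h + lnmean t q * snd h)) (at (t, q))"
proof -
  have [simp]: "wsum 0 t q \<noteq> 0" using wsum0_pos[OF assms, of q] by simp
  have "((\<lambda>p. ln (wsum 0 (fst p) (snd p))) has_derivative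
      (\<lambda>h. (- ln 2 * wsum 0 t (q + 1) * fst h + wsum 1 t q * snd h) * inverse (wsum 0 t q))) (at (t, q))"
    using has_derivative_ln[OF _ wsum_has_derivative[OF assms, of 0 q]] wsum0_pos[OF assms, of q] by simp
  then show ?thesis unfolding press_def lyap_def lnmean_def
    by (rule has_derivative_eq_rhs) (auto simp: field_simps)
qed

lemma lnmean_has_derivative:
  assumes "t > 0"
  shows "((\<lambda>p. lnmean (fst p) (snd p)) has_derivative
          (\<lambda>h. - lncov t q * fst h + lnvar t q * snd h)) (at (t, q))"
proof -
  have [simp]: "wsum 0 t q \<noteq> 0" using wsum0_pos[OF assms, of q] by simp
  show ?thesis unfolding lnmean_def[abs_def]
  proof (rule has_derivative_eq_rhs[OF has_derivative_divide[OF wsum_has_derivative wsum_has_derivative]])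
    let ?A = "wsum 0 t q" and ?B = "wsum 1 t q" and ?C = "wsum 2 t q"
    let ?A1 = "wsum 0 t (q + 1)" and ?B1 = "wsum 1 t (q + 1)"
    have "- ?B * (inverse ?A * (- ln 2 * ?A1 * x + ?B * y) * inverse ?A) + (- ln 2 * ?B1 * x + ?C * y) / ?A
        = - (ln 2 * ?B1 / ?A - ?B / ?A * (ln 2 * ?A1 / ?A)) * x + (?C / ?A - (?B / ?A)\<^sup>2) * y" for x y
      by (simp add: divide_inverse power2_eq_square algebra_simps)
    then show "(\<lambda>h. - wsum 1 (fst (t, q)) (snd (t, q)) *
            (inverse (wsum 0 (fst (t, q)) (snd (t, q))) * (- ln 2 * ?A1 * fst h + wsum (Suc 0) t q * snd h) *
              inverse (wsum 0 (fst (t, q)) (snd (t, q)))) +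
           (- ln 2 * ?B1 * fst h + wsum (Suc 1) t q * snd h) / wsum 0 (fst (t, q)) (snd (t, q)))
        = (\<lambda>h. - lncov t q * fst h + lnvar t q * snd h)"
      by (simp add: lncov_def lnvar_def lyap_def lnmean_def numeral_2_eq_2)
  qed (use assms in auto)
qed

lemma lyap_differentiable:
  assumes "t > 0"
  shows "(\<lambda>p. lyap (fst p) (snd p)) differentiable (at (t, q))"
proof -
  have sh: "((\<lambda>p. (fst p, snd p + 1)) has_derivative (\<lambda>h. h)) (at (t, q))"
    by (auto intro!: derivative_eq_intros)
  have "(\<lambda>p. wsum 0 (fst p) (snd p)) differentiable (at (t, q))" for q
    using wsum_has_derivative[OF assms] unfolding differentiable_def by blast
  moreover have "(\<lambda>p. wsum 0 (fst p) (snd p + 1)) differentiable (at (t, q))"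
    using diff_chain_at[OF sh, of "\<lambda>p. wsum 0 (fst p) (snd p)"] wsum_has_derivative[OF assms, of 0 "q + 1"]
    unfolding differentiable_def by (auto simp: o_def)
  ultimately show ?thesis unfolding lyap_def
    using wsum0_pos[OF assms, of q] by (intro differentiable_divide differentiable_mult differentiable_const) auto
qed

lemma press_deriv_q:
  assumes "t > 0"
  shows "((\<lambda>q. press t q) has_real_derivative lnmean t q) (at q)"
  unfolding press_def lnmean_def using wsum0_pos[OF assms, of q]
  by (auto intro!: derivative_eq_intros wsum_deriv_q[OF assms] simp: field_simps)

lemma lnmean_deriv_q:
  assumes "t > 0"
  shows "((\<lambda>q. lnmean t q) has_real_derivative lnvar t q) (at q)"
proof -
  have [simp]: "wsum 0 t q \<noteq> 0" using wsum0_pos[OF assms, of q] by simp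
  show ?thesis unfolding lnvar_def lnmean_def
    by (rule DERIV_cong[OF DERIV_divide[OF wsum_deriv_q[OF assms] wsum_deriv_q[OF assms]]])
      (auto simp: diff_divide_distrib power2_eq_square numeral_2_eq_2)
qed

text \<open>A variance is a weighted sum of squares. It cannot vanish: the digit 1 has logarithm 0,
  which differs from the positive mean.\<close>

lemma lnvar_pos:
  assumes "t > 0"
  shows "lnvar t q > 0"
proof -
  define m where "m = lnmean t q"
  have W: "wsum 0 t q > 0" using wsum0_pos[OF assms] .
  have m: "m > 0" using lnmean_pos[OF assms] by (simp add: m_def)
  have sm: "summable (\<lambda>k. ln (real (Suc k)) ^ b * weight t q k)" for b
    by (rule summable_weight[OF assms])
  have "(\<lambda>k. (ln (real (Suc k)) ^ 2 * weight t q k - 2 * m * (ln (real (Suc k)) ^ 1 * weight t q k))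
          + m\<^sup>2 * (ln (real (Suc k)) ^ 0 * weight t q k))
        sums (wsum 2 t q - 2 * m * wsum 1 t q + m\<^sup>2 * wsum 0 t q)"
    unfolding wsum_def by (intro sums_add sums_diff sums_mult summable_sums sm)
  also have "(\<lambda>k. (ln (real (Suc k)) ^ 2 * weight t q k - 2 * m * (ln (real (Suc k)) ^ 1 * weight t q k))
          + m\<^sup>2 * (ln (real (Suc k)) ^ 0 * weight t q k)) = (\<lambda>k. (ln (real (Suc k)) - m)\<^sup>2 * weight t q k)"
    by (auto simp: fun_eq_iff power2_eq_square algebra_simps simp del: of_nat_Suc)
  finally have s: "(\<lambda>k. (ln (real (Suc k)) - m)\<^sup>2 * weight t q k) sums (wsum 2 t q - 2 * m * wsum 1 t q + m\<^sup>2 * wsum 0 t q)" .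
  have "(ln (real (Suc 0)) - m)\<^sup>2 * weight t q 0 \<le> wsum 2 t q - 2 * m * wsum 1 t q + m\<^sup>2 * wsum 0 t q"
    using sum_le_suminf[OF sums_summable[OF s], of "{0}"] sums_unique[OF s]
    by (simp add: weight_pos less_imp_le)
  moreover have "0 < (ln (real (Suc 0)) - m)\<^sup>2 * weight t q 0"
    using m by (intro mult_pos_pos weight_pos) auto
  ultimately have "0 < (wsum 2 t q - 2 * m * wsum 1 t q + m\<^sup>2 * wsum 0 t q) / wsum 0 t q" using W by simp
  also have "\<dots> = lnvar t q" using W by (simp add: lnvar_def m_def lnmean_def field_simps power2_eq_square)
  finally show ?thesis .
qed

lemma lnmean_strict_mono: "t > 0 \<Longrightarrow> q < q' \<Longrightarrow> lnmean t q < lnmean t q'"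
  by (rule DERIV_pos_imp_increasing) (auto intro!: exI[of _ "lnvar t _"] lnmean_deriv_q lnvar_pos)

text \<open>The slope \<open>lnmean t\<close> increases with \<open>q\<close>, so the mean value
  theorem on either side of \<open>q'\<close> keeps the graph above its tangent. This is the form in
  which convexity is used below.\<close>

lemma press_tangent:
  assumes "t > 0"
  shows "press t q \<ge> press t q' + lnmean t q' * (q - q')"
proof -
  consider "q = q'" | "q < q'" | "q' < q" by linarith
  then show ?thesis
  proof cases
    case 2
    obtain z where "q < z" "z < q'" "press t q' - press t q = (q' - q) * lnmean t z"
      using MVT2[OF 2 press_deriv_q[OF assms]] by blast
    then show ?thesis using lnmean_strict_mono[OF assms, of z q'] 2
      mult_left_mono[of "lnmean t z" "lnmean t q'" "q' - q"] by (simp add: algebra_simps)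
  next
    case 3
    obtain z where "q' < z" "z < q" "press t q - press t q' = (q - q') * lnmean t z"
      using MVT2[OF 3 press_deriv_q[OF assms]] by blast
    then show ?thesis using lnmean_strict_mono[OF assms, of q' z] 3
      mult_left_mono[of "lnmean t q'" "lnmean t z" "q - q'"] by (simp add: algebra_simps)
  qed auto
qed

lemma wsum_strict_antimono:
  assumes "t > 0" "t < t'"
  shows "wsum 0 t' q < wsum 0 t q"
proof -
  have "0 < (\<Sum>n. weight t q n - weight t' q n)"
  proof (rule suminf_pos)
    show "summable (\<lambda>n. weight t q n - weight t' q n)"
      using assms by (intro summable_diff summable_weight0) auto
    fix n show "0 < weight t q n - weight t' q n"
      using assms unfolding weight_eq_exp
      by (auto intro!: mult_strict_right_mono mult_strict_left_mono)
  qed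
  also have "\<dots> = wsum 0 t q - wsum 0 t' q"
    unfolding wsum_0_eq using assms by (intro suminf_diff[symmetric] summable_weight0) auto
  finally show ?thesis by simp
qed

lemma press_strict_antimono:
  assumes "t > 0" "t < t'"
  shows "press t' q < press t q"
  unfolding press_def using wsum_strict_antimono[OF assms, of q] wsum0_pos assms by simp

lemma press_antimono: "t > 0 \<Longrightarrow> t \<le> t' \<Longrightarrow> press t' q \<le> press t q"
  using press_strict_antimono[of t t' q] by (cases "t = t'") auto

lemma press_mono_q:
  assumes "t > 0" "q \<le> q'" shows "press t q \<le> press t q'"
proof -
  have "wsum 0 t q \<le> wsum 0 t q'" unfolding wsum_0_eq
    using assms by (intro suminf_le summable_weight0 weight_mono_q)
  then show ?thesis unfolding press_def using wsum0_pos[OF assms(1), of q] by simp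
qed

lemma press_ge: "t > 0 \<Longrightarrow> press t q \<ge> q * ln (real (Suc k)) - real (Suc k) * t * ln 2"
  unfolding press_def weight_eq_exp[symmetric]
  using ln_mono[OF wsum_ge[of t q k] weight_pos] by (simp add: weight_eq_exp)

lemma press_isCont:
  assumes "t > 0" shows "isCont (\<lambda>p. press (fst p) (snd p)) (t, q)"
  using has_derivative_continuous[OF press_has_derivative[OF assms]] .

lemma lnmean_isCont:
  assumes "t > 0" shows "isCont (\<lambda>p. lnmean (fst p) (snd p)) (t, q)"
  using has_derivative_continuous[OF lnmean_has_derivative[OF assms]] .

lemma lnmean_isCont_t:
  assumes "t > 0" shows "isCont (\<lambda>t. lnmean t q) t"
  using isCont_o2[of t "\<lambda>t. (t, q)" "\<lambda>p. lnmean (fst p) (snd p)"] lnmean_isCont[OF assms] by simp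

text \<open>At \<open>(1, 0)\<close> the weights are the lengths of the branch intervals, so the
  associated Bernoulli measure codes Lebesgue measure. This is the source of t(\<xi>0) = 1.\<close>

lemma weight_1_0: "weight 1 0 k = (1/2) ^ Suc k"
proof -
  have "weight 1 0 k = 2 powr - real (Suc k)" by (simp add: weight_def)
  also have "\<dots> = inverse (2 ^ Suc k)" by (simp only: powr_minus powr_realpow)
  finally show ?thesis by (simp add: power_one_over field_simps)
qed

lemma wsum_1_0: "wsum 0 1 0 = 1"
  unfolding wsum_0_eq weight_1_0 using power_half_series sums_unique by fastforce

lemma press_1_0: "press 1 0 = 0"
  by (simp add: press_def wsum_1_0)

lemma lnmean_1_0: "lnmean 1 0 = (\<Sum>k. ln (real (Suc k)) * (1/2) ^ Suc k)"
  unfolding lnmean_def wsum_1_0 by (simp add: wsum_def weight_1_0)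

lemma exists_ln_gt: "\<exists>K. ln (real (Suc K)) > (x :: real)"
proof -
  obtain K where "exp x < real K" using reals_Archimedean2 by blast
  then have "exp x < real (Suc K)" by simp
  then have "ln (exp x) < ln (real (Suc K))" by (subst ln_less_cancel_iff) auto
  then show ?thesis by (metis ln_exp)
qed

text \<open>Intermediate value theorem for the slope. For large \<open>q\<close> a single digit with
  logarithm above \<open>\<xi>\<close> forces the pressure to grow faster than
  \<open>\<xi> * q\<close>; for very negative \<open>q\<close> the digit 1 bounds the pressure from
  below, so the slope must be small.\<close>

lemma lnmean_surj:
  assumes t: "t > 0" and xi: "\<xi> > 0"
  shows "\<exists>q. lnmean t q = \<xi>"
proof -
  obtain K where K: "ln (real (Suc K)) > \<xi>" using exists_ln_gt by blast
  \<comment> \<open>Beyond \<open>A\<close> the lower line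
    \<open>q * ln (real (Suc K)) - real (Suc K) * t * ln 2\<close> lies above
    \<open>\<xi> * q + press t 0\<close>.\<close>
  define A where "A = (real (Suc K) * t * ln 2 + press t 0) / (ln (real (Suc K)) - \<xi>)"
  define b where "b = max 1 A"
  have b: "b \<ge> 1" "b * (ln (real (Suc K)) - \<xi>) \<ge> real (Suc K) * t * ln 2 + press t 0"
    using K by (auto simp: b_def A_def field_simps max_def)
  have "lnmean t b * b \<ge> press t b - press t 0"
    using press_tangent[OF t, where q = 0 and q' = b] by (simp add: algebra_simps)
  then have "lnmean t b * b \<ge> \<xi> * b"
    using press_ge[OF t, of b K] b(2) by (simp add: algebra_simps)
  then have ub: "lnmean t b \<ge> \<xi>" using b(1) by simp
  define c where "c = max 1 ((press t 0 + t * ln 2) / \<xi>)"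
  have c: "c \<ge> 1" "press t 0 + t * ln 2 \<le> \<xi> * c"
    using xi by (auto simp: c_def field_simps max_def)
  have "lnmean t (- c) * c \<le> press t 0 - press t (- c)"
    using press_tangent[OF t, where q = 0 and q' = "- c"] by (simp add: algebra_simps)
  then have "lnmean t (- c) * c \<le> \<xi> * c"
    using press_ge[OF t, of "- c" 0] c(2) by simp
  then have lb: "lnmean t (- c) \<le> \<xi>" using c(1) by simp
  have "\<exists>q. - c \<le> q \<and> q \<le> b \<and> lnmean t q = \<xi>"
    by (rule IVT'[where f = "lnmean t", OF lb ub])
      (use b(1) c(1) in \<open>auto intro!: continuous_at_imp_continuous_on DERIV_isCont[OF lnmean_deriv_q[OF t]]\<close>)
  then show ?thesis by blast
qed

text \<open>For \<open>t\<close> near 0 the first digits have almost the weight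
  \<open>real (Suc k) powr q\<close>, and each range of \<open>q\<close> has its own few digits that
  suffice: the digit 1 for \<open>q \<le> - 1\<close>, the first four for
  \<open>- 1 < q < 0\<close>, and two digits with logarithm above \<open>\<xi>\<close> for
  \<open>q \<ge> 0\<close>.\<close>

lemma press_ge_linear_small_t:
  assumes xi: "\<xi> > 0"
  shows "\<exists>t. 0 < t \<and> t < 1 \<and> (\<forall>q. press t q \<ge> q * \<xi>)"
proof -
  obtain K where K: "ln (real (Suc K)) > \<xi>" using exists_ln_gt by blast
  obtain L where L: "1 / \<xi> < real L" using reals_Archimedean2 by blast
  \<comment> \<open>With \<open>t = 1 / M\<close> the factor 2^(-(k+1) t) is at least 1/2 for all
    \<open>k < M\<close>. The summands of \<open>M\<close> guarantee \<open>t < \<xi>\<close>, room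
    for the indices \<open>K\<close> and \<open>K + 1\<close>, and room for four digits.\<close>
  define M where "M = L + K + 4"
  define t where "t = 1 / real M"
  have M: "M \<ge> 4" "K + 1 < M" "real M > 1 / \<xi>" using L by (auto simp: M_def)
  have t: "0 < t" "t < 1" "t < \<xi>" using M xi by (auto simp: t_def field_simps)
  have half: "weight t q k \<ge> exp (q * ln (real (Suc k))) / 2" if "k < M" for q k
  proof -
    have "real (Suc k) * t \<le> 1" using that by (auto simp: t_def)
    then have "real (Suc k) * t * ln 2 \<le> 1 * ln 2" by (intro mult_right_mono) auto
    then have "exp (q * ln (real (Suc k)) - ln 2) \<le> weight t q k" unfolding weight_eq_exp by simp
    then show ?thesis by (simp add: exp_diff)
  qed
  have "exp (q * \<xi>) \<le> wsum 0 t q" for q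
  proof -
    consider "q \<le> - 1" | "- 1 < q" "q < 0" | "q \<ge> 0" by linarith
    then show ?thesis
    proof cases
      case 1
      have "q * \<xi> \<le> - 1 * \<xi>" using 1 xi by (intro mult_right_mono) auto
      also have "\<dots> \<le> - t * ln 2" using t ln_2_less_1 mult_mono[of t \<xi> "ln 2" 1] by simp
      finally have "exp (q * \<xi>) \<le> weight t q 0" by (simp add: powr_def)
      then show ?thesis using wsum_ge[OF t(1), of q 0] by linarith
    next
      case 2
      have "exp (q * \<xi>) \<le> 1" using 2 xi by (simp add: mult_nonpos_nonneg)
      \<comment> \<open>Here 1 + 1/2 + 1/3 + 1/4 = 25/12; four is the least number of terms for
        which the harmonic sum reaches 2.\<close>
      also have "1 \<le> (\<Sum>k<4. exp (- 1 * ln (real (Suc k))) / 2)"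
        by (simp add: exp_minus numeral_eq_Suc)
      also have "\<dots> \<le> (\<Sum>k<4. weight t q k)"
      proof (rule sum_mono)
        fix k :: nat assume k: "k \<in> {..<4}"
        have "- 1 * ln (real (Suc k)) \<le> q * ln (real (Suc k))" using 2 by (intro mult_right_mono) auto
        then have "exp (- 1 * ln (real (Suc k))) / 2 \<le> exp (q * ln (real (Suc k))) / 2"
          by (simp del: mult_minus_left)
        also have "\<dots> \<le> weight t q k" using half[of k q] k M by simp
        finally show "exp (- 1 * ln (real (Suc k))) / 2 \<le> weight t q k" .
      qed
      also have "\<dots> \<le> wsum 0 t q" by (rule wsum_ge_sum[OF t(1)])
      finally show ?thesis .
    next
      case 3
      have g: "exp (q * \<xi>) / 2 \<le> weight t q k" if "K \<le> k" "k < M" for k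
      proof -
        have "\<xi> \<le> ln (real (Suc k))" using K that(1)
          by (smt (verit) ln_mono of_nat_0_less_iff of_nat_mono Suc_le_mono zero_less_Suc)
        then have "exp (q * \<xi>) \<le> exp (q * ln (real (Suc k)))" using 3 by (simp add: mult_left_mono)
        then show ?thesis using half[OF that(2), of q] by linarith
      qed
      have "exp (q * \<xi>) \<le> sum (weight t q) {K, K + 1}" using g[of K] g[of "K + 1"] M by simp
      also have "\<dots> \<le> sum (weight t q) {..<M}"
        using M by (intro sum_mono2) (auto simp: weight_pos less_imp_le)
      also have "\<dots> \<le> wsum 0 t q" by (rule wsum_ge_sum[OF t(1)])
      finally show ?thesis .
    qed
  qed
  then have "q * \<xi> \<le> press t q" for q
    unfolding press_def by (metis exp_gt_zero ln_exp ln_mono)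
  then show ?thesis using t by blast
qed

subsection \<open>The system defining \<open>t\<close> and \<open>q\<close>\<close>

text \<open>The system written for the closed form of the pressure, with the derivative already
  evaluated and \<open>t > 0\<close> imposed. For \<open>\<xi> > 0\<close> it is shown equivalent to
  the original one in \<open>solves_system_iff\<close>.\<close>

definition is_sol :: "real \<Rightarrow> real \<times> real \<Rightarrow> bool" where
  "is_sol \<xi> p \<longleftrightarrow> fst p > 0 \<and> press (fst p) (snd p) = snd p * \<xi> \<and> lnmean (fst p) (snd p) = \<xi>"

text \<open>By the two equations the tangent to \<open>press t\<close> at \<open>q\<close> is the
  line through the origin with slope \<open>\<xi>\<close>. Thus a solution is exactly where the
  minimum over \<open>q\<close> of the pressure minus that line is 0.\<close>

lemma is_sol_minimal:
  assumes "is_sol \<xi> (t, q)"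
  shows "press t q' \<ge> q' * \<xi>"
  using press_tangent[of t q q'] assms by (auto simp: is_sol_def algebra_simps)

text \<open>At fixed slope the intercept is the minimum over \<open>q\<close> of \<open>press t q - q * slope\<close>, hence strictly decreasing in \<open>t\<close>.\<close>

lemma press_legendre_inj:
  assumes "t > 0" "t' > 0" "lnmean t q = lnmean t' q'"
    and "press t q - q * lnmean t q = press t' q' - q' * lnmean t' q'"
  shows "t = t' \<and> q = q'"
proof -
  have *: "\<not> t < t'" if "t > 0" "t' > 0" "lnmean t q = lnmean t' q'"
     "press t q - q * lnmean t q = press t' q' - q' * lnmean t' q'" for t t' q q'
  proof
    assume "t < t'"
    then have "press t' q < press t q" using press_strict_antimono that by blast
    then show False using press_tangent[of t' q' q] that by (simp add: algebra_simps)
  qed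
  have "t = t'" using *[of t t' q q'] *[of t' t q' q] assms by force
  moreover have "q = q'"
    using lnmean_strict_mono[of t q q'] lnmean_strict_mono[of t q' q] assms \<open>t = t'\<close> by force
  ultimately show ?thesis by simp
qed

lemma is_sol_unique: "is_sol \<xi> p \<Longrightarrow> is_sol \<xi> p' \<Longrightarrow> p = p'"
  using press_legendre_inj[of "fst p" "fst p'" "snd p" "snd p'"]
  by (auto simp: is_sol_def prod_eq_iff algebra_simps)

text \<open>The minimiser \<open>Q t\<close> of \<open>press t q - q * \<xi>\<close> depends
  continuously on \<open>t\<close>, so the minimum \<open>g\<close> does too. At
  \<open>t = 1\<close> comparison with the test value 0 gives \<open>g 1 \<le> 0\<close>, and
  \<open>press_ge_linear_small_t\<close> provides the opposite sign.\<close>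

lemma is_sol_exists:
  assumes xi: "\<xi> > 0"
  shows "\<exists>p. is_sol \<xi> p"
proof -
  obtain Q where Q: "\<And>t. t > 0 \<Longrightarrow> lnmean t (Q t) = \<xi>"
    using lnmean_surj[OF _ xi] by metis
  \<comment> \<open>The slopes at \<open>Q t - e\<close> and \<open>Q t + e\<close> lie strictly on
    either side of \<open>\<xi>\<close>. This persists for nearby \<open>s\<close>, and monotonicity
    then traps \<open>Q s\<close> between them.\<close>
  have Qc: "isCont Q t" if t: "t > 0" for t
    unfolding isCont_def
  proof (rule tendstoI)
    fix e :: real assume e: "e > 0"
    have "(\<lambda>s. lnmean s (Q t - e)) \<midarrow>t\<rightarrow> lnmean t (Q t - e)"
      "(\<lambda>s. lnmean s (Q t + e)) \<midarrow>t\<rightarrow> lnmean t (Q t + e)"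
      using lnmean_isCont_t[OF t] by (auto simp: isCont_def)
    moreover have "lnmean t (Q t - e) < \<xi>" "\<xi> < lnmean t (Q t + e)"
      using lnmean_strict_mono[OF t, of "Q t - e" "Q t"] lnmean_strict_mono[OF t, of "Q t" "Q t + e"] e Q[OF t]
      by auto
    ultimately have "\<forall>\<^sub>F s in at t. lnmean s (Q t - e) < \<xi>" "\<forall>\<^sub>F s in at t. \<xi> < lnmean s (Q t + e)"
      by (auto dest: order_tendstoD)
    moreover have "\<forall>\<^sub>F s in at t. s > 0"
      using t eventually_at_in_open'[of "{0<..}" t] by (auto elim: eventually_mono)
    ultimately show "\<forall>\<^sub>F s in at t. dist (Q s) (Q t) < e"
    proof eventually_elim
      case (elim s)
      have "Q t - e < Q s"
        using elim Q[of s] lnmean_strict_mono[of s "Q s" "Q t - e"] by (cases "Q s = Q t - e") force+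
      moreover have "Q s < Q t + e"
        using elim Q[of s] lnmean_strict_mono[of s "Q t + e" "Q s"] by (cases "Q s = Q t + e") force+
      ultimately show ?case by (auto simp: dist_real_def)
    qed
  qed
  define g where "g = (\<lambda>t. press t (Q t) - Q t * \<xi>)"
  have gc: "isCont g t" if t: "t > 0" for t
  proof -
    have "isCont (\<lambda>t. (t, Q t)) t" using Qc[OF t] by (intro continuous_intros)
    from isCont_o2[OF this press_isCont[OF t]] Qc[OF t] show ?thesis
      unfolding g_def by (auto intro!: continuous_intros)
  qed
  obtain t1 where t1: "0 < t1" "t1 < 1" "\<And>q. press t1 q \<ge> q * \<xi>"
    using press_ge_linear_small_t[OF xi] by blast
  have "g 1 \<le> 0" using press_tangent[of 1 "Q 1" 0] Q[of 1] by (simp add: g_def press_1_0 mult.commute)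
  moreover have "0 \<le> g t1" using t1 by (simp add: g_def)
  ultimately have "\<exists>t. t1 \<le> t \<and> t \<le> 1 \<and> g t = 0"
    using t1 by (intro IVT2') (auto intro!: continuous_at_imp_continuous_on gc)
  then obtain t where "t > 0" "g t = 0" using t1(1) less_le_trans by blast
  then have "is_sol \<xi> (t, Q t)" using Q by (simp add: is_sol_def g_def)
  then show ?thesis by blast
qed

definition sol :: "real \<Rightarrow> real \<times> real" where
  "sol \<xi> = (THE p. is_sol \<xi> p)"

abbreviation "tsol \<xi> \<equiv> fst (sol \<xi>)"
abbreviation "qsol \<xi> \<equiv> snd (sol \<xi>)"

lemma is_sol_sol: "\<xi> > 0 \<Longrightarrow> is_sol \<xi> (sol \<xi>)"
  unfolding sol_def by (rule theI') (use is_sol_exists is_sol_unique in blast)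

lemma sol_eq: "is_sol \<xi> p \<Longrightarrow> sol \<xi> = p"
  unfolding sol_def by (rule the_equality) (use is_sol_unique in blast)+

lemma sol_props:
  assumes "\<xi> > 0"
  shows "tsol \<xi> > 0" "press (tsol \<xi>) (qsol \<xi>) = qsol \<xi> * \<xi>" "lnmean (tsol \<xi>) (qsol \<xi>) = \<xi>"
    "press (tsol \<xi>) q' \<ge> q' * \<xi>"
  using is_sol_sol[OF assms] is_sol_minimal[of \<xi> "tsol \<xi>" "qsol \<xi>"] by (auto simp: is_sol_def)

text \<open>The solution curve is the preimage under the Legendre map \<open>F\<close> of the axis
  of points \<open>(\<xi>, 0)\<close>, so its velocity is the inverse derivative applied to
  \<open>(1, 0)\<close>.\<close>

lemma sol_has_derivative:
  assumes xi: "\<xi> > 0"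
  defines "t \<equiv> tsol \<xi>" and "q \<equiv> qsol \<xi>"
  shows "(tsol has_real_derivative - q / lyap t q) (at \<xi>)"
    and "(qsol has_real_derivative (1 - lncov t q * q / lyap t q) / lnvar t q) (at \<xi>)"
proof -
  define S :: "(real \<times> real) set" where "S = {0<..} \<times> UNIV"
  define F where "F = (\<lambda>p. (lnmean (fst p) (snd p), press (fst p) (snd p) - snd p * lnmean (fst p) (snd p)))"
  define g where "g = inv_into S F"
  have t: "t > 0" using sol_props[OF xi] by (simp add: t_def)
  have inj: "inj_on F S"
  proof (rule inj_onI)
    fix x y assume "x \<in> S" "y \<in> S" "F x = F y"
    then show "x = y"
      using press_legendre_inj[of "fst x" "fst y" "snd x" "snd y"]
      by (auto simp: S_def F_def prod_eq_iff mem_Times_iff)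
  qed
  have opS: "open S" unfolding S_def by (intro open_Times) auto
  have lv: "lnvar t q > 0" "lyap t q > 0" using lnvar_pos[OF t] lyap_pos[OF t] by auto
  define F' where "F' = (\<lambda>h. (- lncov t q * fst h + lnvar t q * snd h,
       (- lyap t q * fst h + lnmean t q * snd h)
        - (q * (- lncov t q * fst h + lnvar t q * snd h) + snd h * lnmean t q)))"
  have F': "(F has_derivative F') (at (t, q))"
    unfolding F_def F'_def
    by (rule has_derivative_eq_rhs[OF has_derivative_Pair[OF lnmean_has_derivative[OF t]
       has_derivative_diff[OF press_has_derivative[OF t] has_derivative_mult[OF has_derivative_snd[OF has_derivative_ident] lnmean_has_derivative[OF t]]]]])
      auto
  \<comment> \<open>The \<open>lnmean\<close> terms of \<open>F'\<close> cancel, leaving as second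
    component \<open>- lyap t q * fst h\<close> minus \<open>q\<close> times the first. This
    triangular form is solved for \<open>fst h\<close> and then for \<open>snd h\<close>.\<close>
  define g' where "g' = (\<lambda>y. (- (snd y + q * fst y) / lyap t q,
       (fst y - lncov t q * (snd y + q * fst y) / lyap t q) / lnvar t q))"
  have comp: "F' \<circ> g' = id"
    using lv by (auto simp: F'_def g'_def fun_eq_iff field_simps)
  have "(g has_derivative g') (at (F (t, q)))"
  proof (rule has_derivative_inverse_strong[OF opS, where f = F and x = "(t, q)"])
    show "(t, q) \<in> S" using t by (simp add: S_def)
    show "continuous_on S F"
      unfolding F_def
      by (intro continuous_at_imp_continuous_on ballI)
        (auto simp: S_def intro!: continuous_intros press_isCont lnmean_isCont)
    show "g (F x) = x" if "x \<in> S" for x using inv_into_f_f[OF inj that] by (simp add: g_def)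
  qed (use F' comp in auto)
  moreover have Ftq: "F (t, q) = (\<xi>, 0)" using sol_props[OF xi] by (simp add: F_def t_def q_def)
  ultimately have gd: "(g has_derivative g') (at (\<xi>, 0))" by simp
  have "((\<lambda>\<xi>. (\<xi>, 0)) has_derivative (\<lambda>h. (h, 0 :: real))) (at \<xi>)"
    by (auto intro!: derivative_eq_intros)
  from diff_chain_at[OF this gd] have gd2: "((\<lambda>\<xi>. g (\<xi>, 0)) has_derivative (\<lambda>h. g' (h, 0))) (at \<xi>)"
    by (simp add: o_def)
  have geq: "g (x, 0) = sol x" if "x \<in> {0<..}" for x
  proof -
    have "F (sol x) = (x, 0)" "sol x \<in> S" using that sol_props[of x]
      by (auto simp: F_def S_def mem_Times_iff)
    then show ?thesis using inv_into_f_f[OF inj, of "sol x"] by (simp add: g_def)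
  qed
  have sd: "(sol has_derivative (\<lambda>h. g' (h, 0))) (at \<xi>)"
    by (rule has_derivative_transform_within_open[OF gd2, of "{0<..}"]) (use xi geq in auto)
  show "(tsol has_real_derivative - q / lyap t q) (at \<xi>)"
    unfolding has_field_derivative_def
    by (rule has_derivative_eq_rhs[OF has_derivative_fst[OF sd]]) (simp add: g'_def fun_eq_iff)
  show "(qsol has_real_derivative (1 - lncov t q * q / lyap t q) / lnvar t q) (at \<xi>)"
    unfolding has_field_derivative_def
    by (rule has_derivative_eq_rhs[OF has_derivative_snd[OF sd]]) (simp add: g'_def fun_eq_iff algebra_simps)
qed

subsection \<open>Shape of the spectrum\<close>

text \<open>One test value \<open>q\<close> certifies an upper bound for \<open>tsol\<close>, since
  at \<open>tsol \<xi>\<close> the pressure lies above the line for every \<open>q\<close>.\<close>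

lemma tsol_less:
  assumes "\<xi> > 0" "s > 0" "press s q < q * \<xi>"
  shows "tsol \<xi> < s"
  using press_antimono[of s "tsol \<xi>" q] sol_props(4)[OF assms(1), of q] assms by force

lemma is_sol_1_0: "is_sol (lnmean 1 0) (1, 0)"
  by (simp add: is_sol_def press_1_0)

lemma sol_lnmean_1_0: "sol (lnmean 1 0) = (1, 0)"
  using sol_eq[OF is_sol_1_0] .

lemma tsol_le_1: "\<xi> > 0 \<Longrightarrow> tsol \<xi> \<le> 1"
  using press_strict_antimono[of 1 "tsol \<xi>" 0] sol_props(4)[of \<xi> 0] by (force simp: press_1_0)

lemma qsol_eq_0:
  assumes "\<xi> > 0" "qsol \<xi> = 0" shows "\<xi> = lnmean 1 0"
proof -
  have "press (tsol \<xi>) 0 = 0" using sol_props(2)[OF assms(1)] assms(2) by simp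
  then have "tsol \<xi> = 1"
    using press_strict_antimono[of "tsol \<xi>" 1 0] tsol_le_1[OF assms(1)] sol_props(1)[OF assms(1)]
    by (force simp: press_1_0)
  then show ?thesis using sol_props(3)[OF assms(1)] assms(2) by simp
qed

text \<open>The tangent to \<open>press 1\<close> at 0 has slope \<open>lnmean 1 0\<close>, and
  lowering \<open>t\<close> from 1 to \<open>tsol \<xi>\<close> only raises the pressure. Together
  with \<open>qsol_eq_0\<close> this determines the sign of \<open>qsol\<close>.\<close>

lemma qsol_mult_le:
  assumes "\<xi> > 0" shows "lnmean 1 0 * qsol \<xi> \<le> \<xi> * qsol \<xi>"
proof -
  have "lnmean 1 0 * qsol \<xi> \<le> press 1 (qsol \<xi>)"
    using press_tangent[of 1 0 "qsol \<xi>"] by (simp add: press_1_0)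
  also have "\<dots> \<le> press (tsol \<xi>) (qsol \<xi>)"
    using press_antimono tsol_le_1 sol_props(1) assms by blast
  finally show ?thesis using sol_props(2)[OF assms] by (simp add: mult.commute)
qed

lemma qsol_neg: "0 < \<xi> \<Longrightarrow> \<xi> < lnmean 1 0 \<Longrightarrow> qsol \<xi> < 0"
  using qsol_mult_le[of \<xi>] qsol_eq_0[of \<xi>] by (smt (verit) mult_le_cancel_right)

lemma qsol_pos: "lnmean 1 0 < \<xi> \<Longrightarrow> qsol \<xi> > 0"
  using qsol_mult_le[of \<xi>] qsol_eq_0[of \<xi>] lnmean_pos[of 1 0] by (smt (verit) mult_le_cancel_right)

text \<open>If \<open>tsol \<xi> = 1\<close>, then \<open>press 1 q - q * \<xi>\<close> is
  nonnegative and vanishes at \<open>q = 0\<close>, so its derivative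
  \<open>lnmean 1 0 - \<xi>\<close> there is 0.\<close>

lemma tsol_less_1:
  assumes "\<xi> > 0" "\<xi> \<noteq> lnmean 1 0" shows "tsol \<xi> < 1"
proof (rule ccontr)
  assume "\<not> tsol \<xi> < 1"
  then have t1: "tsol \<xi> = 1" using tsol_le_1[OF assms(1)] by simp
  have "((\<lambda>q. press 1 q - q * \<xi>) has_real_derivative lnmean 1 0 - \<xi>) (at 0)"
    by (auto intro!: derivative_eq_intros press_deriv_q)
  then have "lnmean 1 0 - \<xi> = 0"
    by (rule DERIV_local_min[where d = 1]) (use sol_props(4)[OF assms(1)] in \<open>auto simp: t1 press_1_0\<close>)
  then show False using assms by simp
qed

text \<open>As \<open>q\<close> tends to minus infinity only the digit 1 survives, and its weight
  2^(-s) is below 1. All other digits gain at least the factor 2^(-M).\<close>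

lemma press_neg_exists:
  assumes "s > 0"
  shows "\<exists>M>0. press s (- M) < 0"
proof -
  let ?M = "\<lambda>M::real. 2 powr - s + 2 powr - M * wsum 0 s 0"
  have "(?M \<longlongrightarrow> 2 powr - s + 0 * wsum 0 s 0) at_top"
    by (intro tendsto_intros) real_asymp
  moreover have "2 powr - s < 1" using assms powr_less_mono[of "- s" 0 2] by simp
  ultimately have "\<forall>\<^sub>F M in at_top. ?M M < 1" by (auto dest: order_tendstoD)
  then obtain M where M: "M > 0" "?M M < 1"
    using eventually_conj[OF eventually_gt_at_top[of 0]] eventually_happens'[OF trivial_limit_at_top_linorder] by blast
  have sm: "summable (weight s q)" for q by (rule summable_weight0[OF assms])
  have "wsum 0 s (- M) = weight s (- M) 0 + (\<Sum>k. weight s (- M) (Suc k))"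
    unfolding wsum_0_eq using suminf_split_head[OF sm] by (simp add: algebra_simps)
  also have "(\<Sum>k. weight s (- M) (Suc k)) \<le> (\<Sum>k. 2 powr - M * weight s 0 (Suc k))"
  proof (rule suminf_le)
    fix k
    have "(2::real) powr M \<le> real (Suc (Suc k)) powr M" using M by (intro powr_mono2) auto
    then show "weight s (- M) (Suc k) \<le> 2 powr - M * weight s 0 (Suc k)"
      by (simp add: weight_def powr_minus field_simps del: of_nat_Suc)
  next
    show "summable (\<lambda>k. weight s (- M) (Suc k))" using sm by (subst summable_Suc_iff)
    have "summable (\<lambda>k. weight s 0 (Suc k))" using sm by (subst summable_Suc_iff)
    then show "summable (\<lambda>k. 2 powr - M * weight s 0 (Suc k))" by (rule summable_mult)
  qed
  also have "\<dots> = 2 powr - M * (\<Sum>k. weight s 0 (Suc k))"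
    using sm by (intro suminf_mult) (simp add: summable_Suc_iff)
  also have "\<dots> \<le> 2 powr - M * wsum 0 s 0"
    using suminf_split_head[OF sm, of 0] weight_pos[of s 0 0]
    unfolding wsum_0_eq by (intro mult_left_mono) (auto simp: less_imp_le)
  finally have "wsum 0 s (- M) < 1" using M by simp
  then show ?thesis using M wsum0_pos[OF assms] unfolding press_def by auto
qed

lemma tsol_tendsto_0_at_0: "(tsol \<longlongrightarrow> 0) (at_right 0)"
proof (rule tendstoI)
  fix e :: real assume e: "e > 0"
  obtain M where M: "M > 0" "press e (- M) < 0" using press_neg_exists[OF e] by blast
  \<comment> \<open>The condition \<open>\<xi> < d\<close> says precisely that \<open>- M\<close> is
    a test value for \<open>tsol_less\<close>.\<close>
  define d where "d = - press e (- M) / M"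
  have "d > 0" using M by (simp add: d_def divide_neg_pos)
  then have "\<forall>\<^sub>F \<xi> in at_right 0. \<xi> \<in> {0<..<d}" by (rule eventually_at_right_real)
  then show "\<forall>\<^sub>F \<xi> in at_right 0. dist (tsol \<xi>) 0 < e"
  proof eventually_elim
    case (elim \<xi>)
    then have "press e (- M) < - M * \<xi>" using M by (simp add: d_def field_simps)
    then show ?case using tsol_less[OF _ e, of \<xi> "- M"] elim sol_props(1)[of \<xi>] by auto
  qed
qed

text \<open>The fixed test value \<open>q = 1\<close> works in \<open>tsol_less\<close> as soon as
  \<open>\<xi>\<close> exceeds \<open>press e 1\<close>.\<close>

lemma tsol_tendsto_0_at_top: "(tsol \<longlongrightarrow> 0) at_top"
proof (rule tendstoI)
  fix e :: real assume e: "e > 0"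
  have "\<forall>\<^sub>F \<xi> in at_top. \<xi> > max 0 (press e 1)" by (rule eventually_gt_at_top)
  then show "\<forall>\<^sub>F \<xi> in at_top. dist (tsol \<xi>) 0 < e"
  proof eventually_elim
    case (elim \<xi>)
    then show ?case using tsol_less[OF _ e, of \<xi> 1] sol_props(1)[of \<xi>] by auto
  qed
qed

text \<open>For \<open>\<xi> < \<xi>\<^sub>0\<close> the solution satisfies \<open>wsum 0 t q < 1\<close>, which is impossible for small \<open>t\<close> when \<open>q\<close> stays bounded below.\<close>

lemma qsol_le_eventually: "\<forall>\<^sub>F \<xi> in at_right 0. qsol \<xi> < - M"
proof -
  \<comment> \<open>Only the digits 1 and 2 are kept. As \<open>tsol\<close> tends to 0 their
    weights at \<open>q = - M\<close> add up to 1 + 2^(-M) in the limit, which exceeds 1.\<close>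
  have "((\<lambda>\<xi>. 2 powr - tsol \<xi> + 2 powr - (2 * tsol \<xi>) * 2 powr - M) \<longlongrightarrow> 2 powr - 0 + 2 powr - (2 * 0) * 2 powr - M) (at_right 0)"
    by (intro tendsto_intros tsol_tendsto_0_at_0) auto
  then have "\<forall>\<^sub>F \<xi> in at_right 0. 2 powr - tsol \<xi> + 2 powr - (2 * tsol \<xi>) * 2 powr - M > 1"
    by (rule order_tendstoD) simp
  moreover have "\<forall>\<^sub>F \<xi> in at_right 0. \<xi> \<in> {0<..<lnmean 1 0}"
    by (rule eventually_at_right_real) (simp add: lnmean_pos)
  ultimately show ?thesis
  proof eventually_elim
    case (elim \<xi>)
    then have xi: "\<xi> > 0" "\<xi> < lnmean 1 0" by auto
    show ?case
    proof (rule ccontr)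
      assume "\<not> ?thesis"
      then have q: "- M \<le> qsol \<xi>" by simp
      have t: "tsol \<xi> > 0" using sol_props xi by blast
      have "2 powr - tsol \<xi> + 2 powr - (2 * tsol \<xi>) * 2 powr - M = sum (weight (tsol \<xi>) (- M)) {..<2}"
        by (simp add: numeral_2_eq_2 weight_def)
      also have "\<dots> \<le> wsum 0 (tsol \<xi>) (- M)" by (rule wsum_ge_sum[OF t])
      finally have "1 < wsum 0 (tsol \<xi>) (- M)" using elim by simp
      then have "0 < press (tsol \<xi>) (- M)" unfolding press_def by (rule ln_gt_zero)
      also have "\<dots> \<le> press (tsol \<xi>) (qsol \<xi>)" by (rule press_mono_q[OF t q])
      also have "\<dots> = qsol \<xi> * \<xi>" using sol_props xi by blast
      also have "\<dots> < 0" using qsol_neg[OF xi] xi by (simp add: mult_neg_pos)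
      finally show False .
    qed
  qed
qed

text \<open>For \<open>q \<le> - 3\<close> the shifted exponent \<open>q + 1\<close> is at most -2,
  so the numerator is dominated by the series of inverse squares uniformly in \<open>t\<close>,
  while the digit 1 keeps the denominator above 1/2.\<close>

lemma lyap_bounded:
  assumes "0 < t" "t \<le> 1" "q \<le> - 3"
  shows "lyap t q \<le> 2 * (\<Sum>k. 1 / real (Suc k) ^ 2)"
proof -
  have sm: "summable (\<lambda>k. 1 / real (Suc k) ^ 2)"
    using inverse_power_summable[of 2, where 'a = real] summable_Suc_iff[of "\<lambda>n. inverse (real n ^ 2)"]
    by (simp add: inverse_eq_divide)
  have "wsum 0 t (q + 1) \<le> (\<Sum>k. 1 / real (Suc k) ^ 2)"
    unfolding wsum_0_eq
  proof (rule suminf_le[OF _ summable_weight0[OF assms(1)] sm])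
    fix k
    have "- real (Suc k) * t \<le> 0" using assms by (intro mult_nonpos_nonneg) auto
    then have "2 powr (- real (Suc k) * t) \<le> 2 powr 0" by (intro powr_mono) auto
    moreover have "real (Suc k) powr (q + 1) \<le> real (Suc k) powr (- 2)"
      using assms by (intro powr_mono) auto
    ultimately have "weight t (q + 1) k \<le> 2 powr 0 * real (Suc k) powr (- 2)"
      unfolding weight_def by (intro mult_mono) auto
    then show "weight t (q + 1) k \<le> 1 / real (Suc k) ^ 2"
      by (simp add: powr_minus inverse_eq_divide del: of_nat_Suc)
  qed
  moreover have "wsum 0 t q \<ge> 1/2"
  proof -
    have "2 powr - (1::real) \<le> 2 powr - t" using assms by (intro powr_mono) auto
    then show ?thesis using wsum_ge[OF assms(1), of q 0] by (simp add: powr_minus)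
  qed
  moreover have "ln 2 * wsum 0 t (q + 1) \<le> 1 * wsum 0 t (q + 1)"
    using wsum0_pos[OF assms(1), of "q + 1"] ln_2_less_1 by (intro mult_right_mono) auto
  ultimately have "ln 2 * wsum 0 t (q + 1) / wsum 0 t q \<le> (\<Sum>k. 1 / real (Suc k) ^ 2) / (1/2)"
    using wsum0_pos[OF assms(1), of "q + 1"] by (intro frac_le) linarith+
  then show ?thesis by (simp add: lyap_def)
qed

lemma slope_at_top: "filterlim (\<lambda>\<xi>. - qsol \<xi> / lyap (tsol \<xi>) (qsol \<xi>)) at_top (at_right 0)"
  unfolding filterlim_at_top
proof
  fix Z :: real
  define C where "C = 2 * (\<Sum>k. 1 / real (Suc k) ^ 2)"
  have "\<forall>\<^sub>F \<xi> in at_right 0. \<xi> \<in> {0<..<1::real}" by (rule eventually_at_right_real) simp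
  \<comment> \<open>The 3 is the threshold of \<open>lyap_bounded\<close>; the other bound pushes
    the quotient above \<open>Z\<close>.\<close>
  with qsol_le_eventually[of "max 3 (\<bar>Z\<bar> * C)"]
  show "\<forall>\<^sub>F \<xi> in at_right 0. Z \<le> - qsol \<xi> / lyap (tsol \<xi>) (qsol \<xi>)"
  proof eventually_elim
    case (elim \<xi>)
    then have t: "tsol \<xi> > 0" "tsol \<xi> \<le> 1" using sol_props tsol_le_1 by auto
    have l: "lyap (tsol \<xi>) (qsol \<xi>) \<le> C" "lyap (tsol \<xi>) (qsol \<xi>) > 0"
      using lyap_bounded[OF t, of "qsol \<xi>"] lyap_pos[OF t(1)] elim by (auto simp: C_def)
    have "Z * lyap (tsol \<xi>) (qsol \<xi>) \<le> \<bar>Z\<bar> * C" using l by (intro mult_mono) auto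
    also have "\<dots> \<le> - qsol \<xi>" using elim by simp
    finally show ?case using l(2) by (subst pos_le_divide_eq)
  qed
qed

lemma slope_differentiable:
  assumes "\<xi> > 0"
  shows "(\<lambda>\<xi>. - qsol \<xi> / lyap (tsol \<xi>) (qsol \<xi>)) differentiable (at \<xi>)"
proof -
  have t: "tsol \<xi> > 0" using sol_props assms by blast
  have d: "tsol differentiable (at \<xi>)" "qsol differentiable (at \<xi>)"
    using sol_has_derivative[OF assms] by (auto simp: real_differentiable_def)
  obtain t' q' where "(tsol has_derivative t') (at \<xi>)" "(qsol has_derivative q') (at \<xi>)"
    using d unfolding differentiable_def by blast
  then have "((\<lambda>\<xi>. (tsol \<xi>, qsol \<xi>)) has_derivative (\<lambda>h. (t' h, q' h))) (at \<xi>)"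
    by (rule has_derivative_Pair)
  moreover obtain l' where "((\<lambda>p. lyap (fst p) (snd p)) has_derivative l') (at (tsol \<xi>, qsol \<xi>))"
    using lyap_differentiable[OF t] unfolding differentiable_def by blast
  ultimately have "((\<lambda>\<xi>. lyap (tsol \<xi>) (qsol \<xi>)) has_derivative (\<lambda>h. l' (t' h, q' h))) (at \<xi>)"
    using diff_chain_at by (fastforce simp: o_def)
  then have "(\<lambda>\<xi>. lyap (tsol \<xi>) (qsol \<xi>)) differentiable (at \<xi>)"
    unfolding differentiable_def by blast
  then show ?thesis using d lyap_pos[OF t, of "qsol \<xi>"]
    by (intro differentiable_divide differentiable_minus) auto
qed

text \<open>Since \<open>qsol\<close> vanishes at this point, the difference quotient of the slope
  is that of \<open>- qsol\<close> divided by \<open>lyap\<close> at the moving point. Continuity of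
  \<open>lyap\<close> then gives the value - 1 / (\<open>lnvar 1 0\<close> *
  \<open>lyap 1 0\<close>).\<close>

lemma slope_deriv_xi0:
  defines "x \<equiv> lnmean 1 0"
  shows "\<exists>D<0. ((\<lambda>\<xi>. - qsol \<xi> / lyap (tsol \<xi>) (qsol \<xi>)) has_real_derivative D) (at x)"
proof -
  let ?l = "\<lambda>\<xi>. lyap (tsol \<xi>) (qsol \<xi>)"
  have x: "x > 0" by (simp add: x_def lnmean_pos)
  have s: "tsol x = 1" "qsol x = 0" by (simp_all add: x_def sol_lnmean_1_0)
  obtain D where D: "((\<lambda>\<xi>. - qsol \<xi> / ?l \<xi>) has_real_derivative D) (at x)"
    using slope_differentiable[OF x] by (auto simp: real_differentiable_def)
  have q': "(qsol has_real_derivative 1 / lnvar 1 0) (at x)"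
    using sol_has_derivative(2)[OF x] by (simp add: s)
  have "isCont (\<lambda>p. lyap (fst p) (snd p)) (tsol x, qsol x)"
    using lyap_differentiable[of 1 0] differentiable_imp_continuous_within by (fastforce simp: s)
  moreover have "isCont (\<lambda>\<xi>. (tsol \<xi>, qsol \<xi>)) x"
    by (intro continuous_Pair sol_has_derivative[OF x, THEN DERIV_isCont])
  ultimately have lc: "isCont ?l x" using isCont_o2[of x "\<lambda>\<xi>. (tsol \<xi>, qsol \<xi>)" "\<lambda>p. lyap (fst p) (snd p)"] by simp
  have l1: "((\<lambda>h. (qsol (x + h) - qsol x) / h) \<longlongrightarrow> 1 / lnvar 1 0) (at 0)" using q' by (simp add: DERIV_def)
  have l2: "((\<lambda>h. ?l (x + h)) \<longlongrightarrow> ?l x) (at 0)" using lc by (simp add: isCont_iff)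
  have lp: "?l x > 0" using lyap_pos by (simp add: s)
  then have "((\<lambda>h. - ((qsol (x + h) - qsol x) / h) / ?l (x + h)) \<longlongrightarrow> - (1 / lnvar 1 0) / ?l x) (at 0)"
    by (intro tendsto_divide[OF tendsto_minus[OF l1] l2]) auto
  moreover have "((\<lambda>h. (- qsol (x + h) / ?l (x + h) - - qsol x / ?l x) / h) \<longlongrightarrow> D) (at 0)"
    using D by (simp add: DERIV_def)
  moreover have "(\<lambda>h. (- qsol (x + h) / ?l (x + h) - - qsol x / ?l x) / h) = (\<lambda>h. - ((qsol (x + h) - qsol x) / h) / ?l (x + h))"
    by (auto simp: s fun_eq_iff field_simps)
  ultimately have "D = - (1 / lnvar 1 0) / ?l x" using LIM_unique by force
  also have "\<dots> < 0" using lnvar_pos[of 1 0] lp by (simp add: divide_neg_pos)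
  finally show ?thesis using D by blast
qed

text \<open>Otherwise the slope would be nonincreasing beyond \<xi>0, hence bounded by a negative
  constant, and \<open>tsol\<close> would fall below 0.\<close>

lemma slope_deriv_pos_exists:
  "\<exists>\<xi>1>lnmean 1 0. \<exists>D>0. ((\<lambda>\<xi>. - qsol \<xi> / lyap (tsol \<xi>) (qsol \<xi>)) has_real_derivative D) (at \<xi>1)"
proof (rule ccontr)
  let ?f = "\<lambda>\<xi>. - qsol \<xi> / lyap (tsol \<xi>) (qsol \<xi>)"
  let ?x = "lnmean 1 0"
  assume neg: "\<not> ?thesis"
  have x0: "?x > 0" by (simp add: lnmean_pos)
  define a where "a = ?x + 1"
  have a: "a > 0" "a > ?x" using x0 by (auto simp: a_def)
  have fa: "?f a < 0" using qsol_pos[OF a(2)] lyap_pos sol_props(1)[OF a(1)] by (simp add: divide_neg_pos)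
  have anti: "?f y \<le> ?f a" if "y \<ge> a" for y
  proof (rule DERIV_nonpos_imp_nonincreasing[OF that])
    fix z assume "a \<le> z" "z \<le> y"
    then have z: "z > ?x" "z > 0" using a by auto
    obtain D where D: "(?f has_real_derivative D) (at z)"
      using slope_differentiable[OF z(2)] by (auto simp: real_differentiable_def)
    then have "D \<le> 0" using neg z by (meson not_le)
    then show "\<exists>y. (?f has_real_derivative y) (at z) \<and> y \<le> 0" using D by blast
  qed
  \<comment> \<open>With slope at most \<open>?f a\<close>, an interval of this length forces a drop
    of at least 2, whereas \<open>tsol\<close> takes values in (0, 1].\<close>
  define b where "b = a + 2 / (- ?f a)"
  have "0 < 2 / (- ?f a)" using fa by (intro divide_pos_pos) auto
  then have ab: "a < b" by (simp add: b_def)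
  obtain z where z: "a < z" "z < b" "tsol b - tsol a = (b - a) * ?f z"
    using MVT2[OF ab, of tsol ?f] sol_has_derivative(1) a by force
  have "(b - a) * ?f z \<le> (b - a) * ?f a" using anti[of z] z ab by (intro mult_left_mono) auto
  also have "\<dots> = - 2"
  proof -
    have "2 / (- c) * c = - 2" if "c < 0" for c :: real using that by (simp add: field_simps)
    from this[OF fa] show ?thesis unfolding b_def by (simp only: add_diff_cancel_left')
  qed
  finally show False using z(3) tsol_le_1[OF a(1)] sol_props(1)[of b] ab a by simp
qed

text \<open>The maximum value 1 is attained at the midpoint of two points where the value is
  smaller.\<close>

lemma tsol_not_convex: "\<not> convex_on {0<..} tsol"
proof
  assume c: "convex_on {0<..} tsol"
  let ?x = "lnmean 1 0"
  have x0: "?x > 0" by (simp add: lnmean_pos)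
  have "tsol ((1 - 1/2) *\<^sub>R (?x / 2) + (1/2) *\<^sub>R (3 * ?x / 2)) \<le> (1 - 1/2) * tsol (?x / 2) + (1/2) * tsol (3 * ?x / 2)"
    by (rule convex_onD[OF c]) (use x0 in auto)
  moreover have "tsol (?x / 2) < 1" "tsol (3 * ?x / 2) < 1" using x0 by (auto intro!: tsol_less_1)
  ultimately show False by (simp add: sol_lnmean_1_0)
qed

text \<open>A concave function that stays positive on a half-line cannot fall below an earlier
  value; the far point \<open>?x + 1 / u\<close> makes this quantitative.\<close>

lemma tsol_not_concave: "\<not> concave_on {0<..} tsol"
proof
  assume "concave_on {0<..} tsol"
  then have c: "convex_on {0<..} (\<lambda>x. - tsol x)" by (simp add: concave_on_def)
  let ?x = "lnmean 1 0"
  have x0: "?x > 0" by (simp add: lnmean_pos)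
  \<comment> \<open>Half of the drop from \<open>?x\<close> to \<open>?x + 1\<close>. Concavity
    would allow a drop of less than \<open>u\<close> only.\<close>
  define u where "u = (1 - tsol (?x + 1)) / 2"
  have tl: "tsol (?x + 1) < 1" "tsol (?x + 1) > 0" using x0 sol_props(1)[of "?x + 1"] by (auto intro!: tsol_less_1)
  then have u: "0 < u" "u < 1" by (auto simp: u_def)
  have "- tsol ((1 - u) *\<^sub>R ?x + u *\<^sub>R (?x + 1 / u)) \<le> (1 - u) * (- tsol ?x) + u * (- tsol (?x + 1 / u))"
    by (rule convex_onD[OF c]) (use x0 u in \<open>auto intro!: add_pos_pos\<close>)
  moreover have "(1 - u) *\<^sub>R ?x + u *\<^sub>R (?x + 1 / u) = ?x + 1" using u by (simp add: field_simps)
  moreover have "u * tsol (?x + 1 / u) > 0" using u x0 sol_props(1)[of "?x + 1 / u"] by (simp add: add_pos_pos)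
  ultimately have "tsol (?x + 1) > 1 - u" by (simp add: sol_lnmean_1_0)
  then show False using tl by (simp add: u_def field_simps)
qed

subsection \<open>Symbolic dynamics and the pressure\<close>

lemma words_0: "words 0 = {[]}"
  by (auto simp: words_def)

lemma words_Suc: "words (Suc n) = (\<lambda>(k, w). Suc k # w) ` (UNIV \<times> words n)"
proof -
  have "w \<in> (\<lambda>(k, w). Suc k # w) ` (UNIV \<times> words n)" if w: "w \<in> words (Suc n)" for w
  proof (cases w)
    case (Cons a v)
    then obtain k where "a = Suc k" using w by (cases a) (auto simp: words_def)
    then show ?thesis using Cons w by (auto simp: words_def image_iff)
  qed (use w in \<open>simp add: words_def\<close>)
  then show ?thesis by (auto simp: words_def)
qed

text \<open>Expanding the \<open>n\<close>-th power of a nonnegative series gives one product for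
  each word. This factorisation serves both the pressure and the covering sums.\<close>

lemma has_sum_words:
  fixes g :: "nat \<Rightarrow> real"
  assumes "\<And>k. g (Suc k) \<ge> 0" "(\<lambda>k. g (Suc k)) sums S"
  shows "((\<lambda>w. prod_list (map g w)) has_sum S ^ n) (words n)"
proof (induction n)
  case 0
  show ?case by (simp add: words_0 has_sum_finiteI)
next
  case (Suc n)
  let ?h = "\<lambda>(k, w). g (Suc k) * prod_list (map g w)"
  have nn: "prod_list (map g w) \<ge> 0" if "w \<in> words n" for w
  proof (rule prod_list_nonneg)
    fix x assume "x \<in> set (map g w)"
    then obtain k where "k \<in> set w" "x = g k" by auto
    then show "x \<ge> 0" using that assms(1)[of "k - 1"] by (auto simp: words_def)
  qed
  have 1: "((\<lambda>w. ?h (k, w)) has_sum g (Suc k) * S ^ n) (words n)" for k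
    using has_sum_cmult_right[OF Suc.IH] by simp
  have 2: "((\<lambda>k. g (Suc k) * S ^ n) has_sum S * S ^ n) UNIV"
    by (intro has_sum_cmult_left sums_nonneg_imp_has_sum assms)
  have "?h summable_on UNIV \<times> words n"
    by (rule summable_on_SigmaI[OF 1 has_sum_imp_summable[OF 2]]) (use nn assms(1) in auto)
  from has_sum_SigmaI[OF 1 2 this] have "(?h has_sum S ^ Suc n) (UNIV \<times> words n)" by simp
  moreover have "inj_on (\<lambda>(k, w). Suc k # w) (UNIV \<times> words n)" by (auto simp: inj_on_def)
  ultimately show ?case
    unfolding words_Suc by (subst has_sum_reindex) (auto simp: o_def case_prod_unfold)
qed

text \<open>The sequence \<open>a\<close> codes the point whose \<open>n\<close>-th digit is \<open>Suc (a n)\<close>, so that every sequence is admissible.\<close>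

definition code :: "(nat \<Rightarrow> nat) \<Rightarrow> real" where
  "code a = (\<Sum>n. (1/2) ^ (\<Sum>j\<le>n. Suc (a j)))"

lemma code_term_le: "(1/2 :: real) ^ (\<Sum>j\<le>n. Suc (a j)) \<le> (1/2) ^ Suc n"
proof (rule power_decreasing)
  have "(\<Sum>j\<le>n. 1) \<le> (\<Sum>j\<le>n. Suc (a j))" by (rule sum_mono) simp
  then show "Suc n \<le> (\<Sum>j\<le>n. Suc (a j))" by simp
qed auto

lemma summable_code: "summable (\<lambda>n. (1/2 :: real) ^ (\<Sum>j\<le>n. Suc (a j)))"
  by (rule summable_comparison_test'[where g = "\<lambda>n. (1/2) ^ Suc n"])
    (use code_term_le power_half_series in \<open>auto simp: sums_iff\<close>)

lemma code_bounds: "0 < code a" "code a \<le> 1"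
proof -
  show "0 < code a" unfolding code_def by (intro suminf_pos summable_code) simp
  have "code a \<le> (\<Sum>n. (1/2) ^ Suc n)"
    unfolding code_def using power_half_series
    by (intro suminf_le summable_code code_term_le) (auto simp: sums_iff)
  then show "code a \<le> 1" using power_half_series sums_unique by fastforce
qed

text \<open>The inverse branch with digit \<open>Suc k\<close> is y |-> (1 + y) / 2^(k+1); prefixing
  a digit to a sequence applies it to the coded point.\<close>

lemma code_rec: "code a = (1 + code (\<lambda>n. a (Suc n))) / 2 ^ Suc (a 0)"
proof -
  have "code a = (1/2) ^ Suc (a 0) + (\<Sum>n. (1/2) ^ (\<Sum>j\<le>Suc n. Suc (a j)))"
    unfolding code_def using suminf_split_head[OF summable_code[of a]] by simp
  also have "(\<Sum>n. (1/2 :: real) ^ (\<Sum>j\<le>Suc n. Suc (a j))) = (1/2) ^ Suc (a 0) * code (\<lambda>n. a (Suc n))"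
    unfolding code_def by (subst suminf_mult[OF summable_code, symmetric])
      (simp only: sum.atMost_Suc_shift power_add)
  finally show ?thesis by (simp add: power_one_over field_simps)
qed

section \<open>Branches of T, digits of coded points, and cylinders\<close>

lemma d1_ge_1: "d1 x \<ge> 1"
  by (simp add: d1_def)

lemma d1_branch:
  assumes "0 < y" "y \<le> 1"
  shows "d1 ((1 + y) / 2 ^ Suc k) = Suc k"
proof -
  have "log 2 ((1 + y) / 2 ^ Suc k) = log 2 (1 + y) - real (Suc k)"
    using assms log_nat_power[of 2 2 "Suc k"] by (subst log_divide) (auto simp del: power_Suc)
  \<comment> \<open>The half-open range fits the floor in \<open>d1\<close>: \<open>y = 1\<close>
    gives exactly \<open>k\<close>, and only \<open>y = 0\<close> would give
    \<open>k + 1\<close>.\<close>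
  moreover have "0 < log 2 (1 + y)" "log 2 (1 + y) \<le> 1" using assms by auto
  ultimately have "\<lfloor>- log 2 ((1 + y) / 2 ^ Suc k)\<rfloor> = int k"
    by (intro floor_unique) auto
  then show ?thesis by (simp add: d1_def)
qed

lemma T_branch:
  assumes "0 < y" "y \<le> 1"
  shows "T ((1 + y) / 2 ^ Suc k) = y"
  unfolding T_def d1_branch[OF assms] by simp

lemma d1_bounds:
  assumes "0 < x" "x \<le> 1"
  shows "1 < 2 ^ d1 x * x" "2 ^ d1 x * x \<le> 2"
proof -
  define m where "m = \<lfloor>- log 2 x\<rfloor>"
  have "- log 2 x \<ge> 0" using assms by simp
  then have m: "m \<ge> 0" by (simp add: m_def)
  have d: "real (d1 x) = of_int m + 1" using m by (simp add: d1_def m_def)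
  have "2 ^ d1 x * x = 2 powr (real (d1 x) + log 2 x)"
    using assms by (simp add: powr_add powr_realpow)
  moreover have "of_int m \<le> - log 2 x" "- log 2 x < of_int m + 1" by (auto simp: m_def)
  ultimately have "2 ^ d1 x * x = 2 powr (real (d1 x) + log 2 x)" "0 < real (d1 x) + log 2 x" "real (d1 x) + log 2 x \<le> 1"
    using d by auto
  then show "1 < 2 ^ d1 x * x" "2 ^ d1 x * x \<le> 2"
    using powr_mono[of "real (d1 x) + log 2 x" 1 2] by auto
qed

lemma T_range: "x \<in> {0<..1} \<Longrightarrow> T x \<in> {0<..1}"
  using d1_bounds[of x] by (auto simp: T_def)

lemma T_code: "T (code a) = code (\<lambda>n. a (Suc n))"
  by (subst code_rec) (rule T_branch[OF code_bounds])

lemma d1_code: "d1 (code a) = Suc (a 0)"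
  by (subst code_rec) (rule d1_branch[OF code_bounds])

lemma funpow_T_code: "(T ^^ n) (code a) = code (\<lambda>i. a (n + i))"
  by (induction n arbitrary: a) (simp_all add: T_code)

lemma digit_code: "d1 ((T ^^ n) (code a)) = Suc (a n)"
  by (simp add: funpow_T_code d1_code)

lemma branch_sep:
  assumes "d1 x = d1 y" shows "\<bar>x - y\<bar> = (1/2) ^ d1 x * \<bar>T x - T y\<bar>"
proof -
  have "T x - T y = 2 ^ d1 x * (x - y)" using assms by (simp add: T_def algebra_simps)
  then show ?thesis by (simp add: abs_mult power_one_over)
qed

text \<open>Each common digit contracts distances by its branch slope, and after \<open>n\<close>
  steps both points still lie in (0, 1].\<close>

lemma cylinder_diam:
  assumes "x \<in> {0<..1}" "y \<in> {0<..1}" "\<And>j. j < n \<Longrightarrow> d1 ((T ^^ j) x) = d1 ((T ^^ j) y)"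
  shows "\<bar>x - y\<bar> \<le> (1/2) ^ (\<Sum>j<n. d1 ((T ^^ j) x))"
  using assms
proof (induction n arbitrary: x y)
  case (Suc n)
  have "\<bar>T x - T y\<bar> \<le> (1/2) ^ (\<Sum>j<n. d1 ((T ^^ j) (T x)))"
  proof (rule Suc.IH)
    fix j assume "j < n"
    then show "d1 ((T ^^ j) (T x)) = d1 ((T ^^ j) (T y))"
      using Suc.prems(3)[of "Suc j"] by (simp add: funpow_Suc_right del: funpow.simps)
  qed (use Suc.prems T_range in auto)
  then have "\<bar>x - y\<bar> \<le> (1/2) ^ d1 x * (1/2) ^ (\<Sum>j<n. d1 ((T ^^ j) (T x)))"
    using branch_sep[of x y] Suc.prems(3)[of 0] by simp
  also have "\<dots> = (1/2) ^ (\<Sum>j<Suc n. d1 ((T ^^ j) x))"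
    by (simp add: sum.lessThan_Suc_shift power_add funpow_Suc_right del: funpow.simps sum.lessThan_Suc)
  finally show ?case .
qed auto

definition cyl :: "nat list \<Rightarrow> real set" where
  "cyl w = {x \<in> {0<..1}. \<forall>j<length w. d1 ((T ^^ j) x) = w ! j}"

lemma cyl_nonempty:
  assumes "w \<in> words n" shows "\<exists>x. x \<in> cyl w"
proof
  let ?a = "\<lambda>j. if j < n then w ! j - 1 else 0"
  have "Suc (w ! j - 1) = w ! j" if "j < n" for j
  proof -
    have "w ! j \<in> set w" using that assms by (auto simp: words_def)
    then show ?thesis using assms by (auto simp: words_def)
  qed
  then show "code ?a \<in> cyl w"
    using assms code_bounds by (auto simp: cyl_def digit_code words_def)
qed

lemma diameter_cyl:
  "bounded (cyl w)" "diameter (cyl w) \<le> (1/2) ^ sum_list w"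
proof -
  have "(\<Sum>j<length w. d1 ((T ^^ j) x)) = sum_list w" if "x \<in> cyl w" for x
    using that by (simp add: cyl_def sum_list_sum_nth atLeast0LessThan)
  then have *: "\<bar>x - y\<bar> \<le> (1/2) ^ sum_list w" if "x \<in> cyl w" "y \<in> cyl w" for x y
    using cylinder_diam[of x y "length w"] that by (auto simp: cyl_def)
  then show "diameter (cyl w) \<le> (1/2) ^ sum_list w" by (intro diameter_le) auto
  show "bounded (cyl w)" by (rule bounded_subset[of "{0..1}"]) (auto simp: cyl_def)
qed

section \<open>The pressure as the logarithm of the weighted series\<close>

lemma exp_eq_weight: "exp (- t * ln \<bar>2 ^ Suc k\<bar> + q * ln (real (Suc k))) = weight t q k"
  unfolding weight_eq_exp by (simp add: ln_realpow algebra_simps del: of_nat_Suc power_Suc)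

text \<open>|T'| and \<open>phi\<close> depend on the digit alone, so the Birkhoff sum is constant
  on a cylinder. Cylinders are nonempty, so the supremum is taken over a singleton.\<close>

lemma pressure_term_eq:
  assumes "w \<in> words n"
  shows "pressure_term n t q w = prod_list (map (\<lambda>k. weight t q (k - 1)) w)"
proof -
  have len: "length w = n" using assms by (simp add: words_def)
  have "{(\<Sum>j<n. - t * ln \<bar>Tderiv ((T ^^ j) x)\<bar> + q * phi ((T ^^ j) x)) | x.
                 x \<in> {0<..1} \<and> (\<forall>j<n. d1 ((T ^^ j) x) = w ! j)}
     = {\<Sum>j<n. - t * ln \<bar>2 ^ (w ! j)\<bar> + q * ln (real (w ! j))}" (is "?A = {?s}")
  proof -
    have "(\<Sum>j<n. - t * ln \<bar>Tderiv ((T ^^ j) x)\<bar> + q * phi ((T ^^ j) x)) = ?s"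
      if "\<forall>j<n. d1 ((T ^^ j) x) = w ! j" for x
      using that by (intro sum.cong) (auto simp: Tderiv_def phi_def)
    moreover obtain x where "x \<in> cyl w" using cyl_nonempty[OF assms] by blast
    moreover from this have "x \<in> {0<..1} \<and> (\<forall>j<n. d1 ((T ^^ j) x) = w ! j)" by (simp add: cyl_def len)
    moreover have *: "{f x |x. P x} = {s}" if "\<And>x. P x \<Longrightarrow> f x = s" "P x" for f :: "real \<Rightarrow> real" and P s x
      using that by blast
    ultimately show ?thesis by (intro *) auto
  qed
  then have "pressure_term n t q w = exp ?s" by (simp add: pressure_term_def)
  also have "\<dots> = (\<Prod>j<n. exp (- t * ln \<bar>2 ^ (w ! j)\<bar> + q * ln (real (w ! j))))"
    by (simp add: exp_sum)
  also have "\<dots> = (\<Prod>j<n. weight t q (w ! j - 1))"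
  proof (rule prod.cong)
    fix j assume "j \<in> {..<n}"
    then have "w ! j \<in> set w" using len by auto
    then have "w ! j = Suc (w ! j - 1)" using assms by (auto simp: words_def)
    then show "exp (- t * ln \<bar>2 ^ (w ! j)\<bar> + q * ln (real (w ! j))) = weight t q (w ! j - 1)"
      using exp_eq_weight[of t "w ! j - 1" q] by metis
  qed simp
  also have "\<dots> = prod_list (map (\<lambda>k. weight t q (k - 1)) w)"
    using len by (simp add: prod.list_conv_set_nth atLeast0LessThan)
  finally show ?thesis .
qed

lemma partition_sum_has_sum:
  assumes "summable (weight t q)"
  shows "(pressure_term n t q has_sum wsum 0 t q ^ n) (words n)"
proof -
  have "((\<lambda>w. prod_list (map (\<lambda>k. weight t q (k - 1)) w)) has_sum wsum 0 t q ^ n) (words n)"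
    by (rule has_sum_words) (use assms in \<open>auto simp: wsum_0_eq weight_pos less_imp_le summable_sums\<close>)
  then show ?thesis by (simp only: has_sum_cong[OF pressure_term_eq])
qed

text \<open>Words of length 1 already recover the series of weights; conversely a convergent series
  has convergent powers over words of each length.\<close>

lemma pressure_domain_eq: "pressure_domain = {(t, q). summable (weight t q)}"
proof -
  have "summable (weight t q)" if "pressure_term 1 t q summable_on words 1" for t q
  proof -
    have w1: "words 1 = (\<lambda>k. [Suc k]) ` UNIV" using words_Suc[of 0] by (auto simp: words_0)
    have "pressure_term 1 t q [Suc k] = weight t q k" for k
      using pressure_term_eq[of "[Suc k]" 1 t q] by (simp add: words_def)
    then have "weight t q summable_on UNIV"
      using that unfolding w1 by (subst (asm) summable_on_reindex) (auto simp: inj_on_def o_def)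
    then show ?thesis by (rule summable_on_imp_summable)
  qed
  moreover have "pressure_term n t q summable_on words n" if "summable (weight t q)" for n t q
    using has_sum_imp_summable[OF partition_sum_has_sum[OF that]] .
  ultimately show ?thesis by (auto simp: pressure_domain_def)
qed

lemma partition_sum_eq: "summable (weight t q) \<Longrightarrow> partition_sum n t q = wsum 0 t q ^ n"
  unfolding partition_sum_def by (rule infsumI) (rule partition_sum_has_sum)

lemma partition_sum_tendsto:
  assumes "summable (weight t q)"
  shows "(\<lambda>n. ln (partition_sum n t q) / real n) \<longlonglongrightarrow> press t q"
proof (rule tendsto_eventually)
  have "wsum 0 t q > 0" unfolding wsum_0_eq by (intro suminf_pos assms weight_pos)
  show "\<forall>\<^sub>F n in sequentially. ln (partition_sum n t q) / real n = press t q"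
    using eventually_gt_at_top[of "0 :: nat"]
    by eventually_elim (simp add: partition_sum_eq[OF assms] ln_realpow press_def)
qed

lemma pressure_eq: "summable (weight t q) \<Longrightarrow> pressure t q = press t q"
  unfolding pressure_def by (rule limI) (rule partition_sum_tendsto)

text \<open>The point is to exclude \<open>t \<le> 0\<close>. There the digit 1 has weight at least
  1, so the pressure is nonnegative and \<open>\<xi> > 0\<close> forces \<open>q \<ge> 0\<close>;
  but then all weights are at least 1 and the series diverges.\<close>

lemma solves_system_iff:
  assumes "\<xi> > 0"
  shows "solves_system \<xi> p \<longleftrightarrow> is_sol \<xi> p"
proof (cases p)
  case (Pair t q)
  show ?thesis
  proof (cases "t > 0")
    case True
    then have "(\<lambda>q. pressure t q) = press t" using pressure_eq summable_weight0 by blast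
    then show ?thesis using True summable_weight0 press_deriv_q[OF True, of q]
      by (auto simp: Pair solves_system_def is_sol_def pressure_domain_eq dest: DERIV_unique)
  next
    case False
    have "\<not> solves_system \<xi> p"
    proof
      assume s: "solves_system \<xi> p"
      then have sm: "summable (weight t q)" by (simp add: Pair solves_system_def pressure_domain_eq)
      have "weight t q 0 \<le> wsum 0 t q"
        unfolding wsum_0_eq using sum_le_suminf[OF sm, of "{0}"] by (simp add: weight_pos less_imp_le)
      moreover have "weight t q 0 \<ge> 1" using False by (simp add: ge_one_powr_ge_zero)
      ultimately have "press t q \<ge> 0" by (simp add: press_def)
      then have q: "q \<ge> 0" using s sm assms by (simp add: Pair solves_system_def pressure_eq zero_le_mult_iff)
      have "weight t q k \<ge> 1" for k
      proof -
        have "real (Suc k) * t \<le> 0" using False by (intro mult_nonneg_nonpos) auto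
        then have "real (Suc k) * t * ln 2 \<le> 0" by (rule mult_nonpos_nonneg) simp
        moreover have "q * ln (real (Suc k)) \<ge> 0" using q by simp
        ultimately have "0 \<le> q * ln (real (Suc k)) - real (Suc k) * t * ln 2" by linarith
        then show ?thesis by (simp only: weight_eq_exp one_le_exp_iff)
      qed
      moreover have "\<forall>\<^sub>F k in sequentially. weight t q k < 1"
        using order_tendstoD(2)[OF summable_LIMSEQ_zero[OF sm], of 1] by simp
      ultimately show False by (auto simp: not_less[symmetric])
    qed
    then show ?thesis using False by (simp add: Pair is_sol_def)
  qed
qed

lemma t_of_eq: "\<xi> > 0 \<Longrightarrow> t_of \<xi> = tsol \<xi>"
  unfolding t_of_def sol_def by (rule arg_cong[where f = "\<lambda>P. fst (The P)"]) (simp add: fun_eq_iff solves_system_iff)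

subsection \<open>Upper bound for the dimension\<close>

text \<open>Words of length \<open>n\<close> contribute at most \<open>\<rho> ^ n\<close>, so
  grouping by length leaves the tail of a geometric series.\<close>

lemma wordweight_sum_le:
  fixes g :: "nat \<Rightarrow> real"
  assumes g: "\<And>k. g (Suc k) \<ge> 0" "(\<lambda>k. g (Suc k)) sums \<rho>" and rho: "\<rho> < 1"
    and F: "finite F" "F \<subseteq> (\<Union>n\<in>{N..}. words n)"
  shows "(\<Sum>w\<in>F. prod_list (map g w)) \<le> \<rho> ^ N / (1 - \<rho>)"
proof -
  let ?P = "\<lambda>w. prod_list (map g w)"
  have rho0: "\<rho> \<ge> 0" using sums_unique[OF g(2)] suminf_nonneg[OF sums_summable[OF g(2)]] g(1) by metis
  let ?A = "length ` F"
  have A: "finite ?A" "?A \<subseteq> {N..}" using F by (auto simp: words_def)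
  have nn: "?P w \<ge> 0" if "w \<in> words n" for w n
  proof (rule prod_list_nonneg)
    fix x assume "x \<in> set (map g w)"
    then obtain k where "k \<in> set w" "x = g k" by auto
    then show "x \<ge> 0" using that g(1)[of "k - 1"] by (auto simp: words_def)
  qed
  have "(\<Sum>w\<in>F. ?P w) = (\<Sum>n\<in>?A. \<Sum>w\<in>{w \<in> F. length w = n}. ?P w)"
    by (rule sum.group[symmetric]) (use F A in auto)
  also have "\<dots> \<le> (\<Sum>n\<in>?A. \<rho> ^ n)"
  proof (rule sum_mono)
    fix n assume "n \<in> ?A"
    show "(\<Sum>w\<in>{w \<in> F. length w = n}. ?P w) \<le> \<rho> ^ n"
      by (rule finite_sum_le_has_sum[OF has_sum_words[OF g]])
        (use F nn in \<open>auto simp: words_def\<close>)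
  qed
  also have "\<dots> = (\<Sum>n\<in>?A. \<rho> ^ N * \<rho> ^ (n - N))"
    using A by (intro sum.cong) (auto simp: power_add[symmetric])
  also have "\<dots> = \<rho> ^ N * (\<Sum>m\<in>(\<lambda>n. n - N) ` ?A. \<rho> ^ m)"
  proof -
    have "inj_on (\<lambda>n. n - N) ?A"
    proof (rule inj_onI)
      fix m n assume "m \<in> ?A" "n \<in> ?A" "m - N = n - N"
      moreover from this have "N \<le> m" "N \<le> n" using A(2) by blast+
      ultimately show "m = n" by simp
    qed
    from sum.reindex[OF this, of "\<lambda>m. \<rho> ^ m"] show ?thesis by (simp only: sum_distrib_left o_def)
  qed
  also have "(\<Sum>m\<in>(\<lambda>n. n - N) ` ?A. \<rho> ^ m) \<le> (\<Sum>m. \<rho> ^ m)"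
    using A rho rho0 by (intro sum_le_suminf summable_geometric) auto
  also have "(\<Sum>m. \<rho> ^ m) = 1 / (1 - \<rho>)" using rho rho0 by (intro suminf_geometric) auto
  finally show ?thesis using rho0 by (simp add: mult_left_mono)
qed

lemma hausdorff_measure_zeroI:
  assumes "\<And>\<delta> e. \<delta> > 0 \<Longrightarrow> e > 0 \<Longrightarrow> hausdorff_approx s \<delta> E \<le> ennreal e"
  shows "hausdorff_measure s E = 0"
proof -
  have "hausdorff_approx s \<delta> E = 0" if "\<delta> > 0" for \<delta>
  proof -
    have "hausdorff_approx s \<delta> E \<le> 0"
      by (rule ennreal_le_epsilon) (use assms[OF that] in auto)
    then show ?thesis by simp
  qed
  then show ?thesis unfolding hausdorff_measure_def by simp
qed

text \<open>Every point of \<open>E_phi \<xi>\<close> lies in cylinders of arbitrarily large length whose logarithmic digit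
  average is \<open>\<epsilon>\<close>-close to \<open>\<xi>\<close>; these cylinders are the covers.\<close>

lemma hausdorff_measure_E_phi_zero:
  assumes s: "s > 0" and lt: "press s q < q * \<xi>"
  shows "hausdorff_measure s (E_phi \<xi>) = 0"
proof (rule hausdorff_measure_zeroI)
  fix \<delta> e :: real assume \<delta>: "\<delta> > 0" and e: "e > 0"
  \<comment> \<open>The added 1 covers \<open>q = 0\<close> and makes
    \<open>\<bar>q\<bar> * \<epsilon>\<close> strictly smaller than the gap in
    \<open>lt\<close>.\<close>
  define \<epsilon> where "\<epsilon> = (q * \<xi> - press s q) / (\<bar>q\<bar> + 1)"
  have eps: "\<epsilon> > 0" using lt by (simp add: \<epsilon>_def)
  have "\<bar>q\<bar> * \<epsilon> < (\<bar>q\<bar> + 1) * \<epsilon>" using eps by simp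
  also have "\<dots> = q * \<xi> - press s q" by (simp add: \<epsilon>_def)
  finally have qe: "press s q - q * \<xi> + \<bar>q\<bar> * \<epsilon> < 0" by simp
  \<comment> \<open>For words in \<open>W\<close> the total
    \<open>q * (\<Sum>k\<leftarrow>w. ln (real k))\<close> plus \<open>length w * c\<close> is
    nonnegative. The factor \<open>exp c\<close> per digit therefore lifts the weight of the word
    above the \<open>s\<close>-th power of the cylinder's diameter bound, while the choice of
    \<open>\<epsilon>\<close> keeps \<open>\<rho> < 1\<close>.\<close>
  define c where "c = \<bar>q\<bar> * \<epsilon> - q * \<xi>"
  define \<rho> where "\<rho> = wsum 0 s q * exp c"
  have W: "wsum 0 s q > 0" using wsum0_pos[OF s] .
  have "\<rho> = exp (press s q + c)" using W by (simp add: \<rho>_def press_def exp_add)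
  then have rho: "0 < \<rho>" "\<rho> < 1" using qe by (auto simp: c_def)
  define g where "g = (\<lambda>k. weight s q (k - 1) * exp c)"
  have g: "g (Suc k) \<ge> 0" "(\<lambda>k. g (Suc k)) sums \<rho>" for k
    unfolding g_def \<rho>_def wsum_0_eq using summable_weight0[OF s]
    by (auto intro!: sums_mult2 summable_sums simp: weight_pos less_imp_le)
  have "(\<lambda>N. \<rho> ^ N / (1 - \<rho>)) \<longlonglongrightarrow> 0 / (1 - \<rho>)"
    using rho by (intro tendsto_divide LIMSEQ_power_zero) auto
  then have "\<forall>\<^sub>F N in sequentially. \<rho> ^ N / (1 - \<rho>) < e" by (rule order_tendstoD) (use e in auto)
  moreover have "\<forall>\<^sub>F N in sequentially. (1/2::real) ^ N < \<delta>"
    by (rule order_tendstoD[OF LIMSEQ_power_zero]) (use \<delta> in auto)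
  ultimately obtain N where N: "\<rho> ^ N / (1 - \<rho>) < e" "(1/2::real) ^ N < \<delta>"
    using eventually_happens'[OF sequentially_bot eventually_conj] by blast
  define W where "W = {w. N \<le> length w \<and> w \<in> words (length w) \<and>
      \<bar>(\<Sum>k\<leftarrow>w. ln (real k)) - real (length w) * \<xi>\<bar> \<le> real (length w) * \<epsilon>}"
  \<comment> \<open>Indices that encode no word of \<open>W\<close> give the empty set, whose
    diameter 0 contributes \<open>0 powr s = 0\<close>.\<close>
  define U where "U = (\<lambda>i. if i \<in> to_nat ` W then cyl (from_nat i) else {})"
  have cover: "E_phi \<xi> \<subseteq> (\<Union>i. U i)"
  proof
    fix x assume x: "x \<in> E_phi \<xi>"
    then have x01: "x \<in> {0<..1}" and lim: "(\<lambda>n. (\<Sum>j<n. phi ((T ^^ j) x)) / real n) \<longlonglongrightarrow> \<xi>"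
      by (auto simp: E_phi_def)
    have "\<forall>\<^sub>F n in sequentially. dist ((\<Sum>j<n. phi ((T ^^ j) x)) / real n) \<xi> < \<epsilon>"
      by (rule tendstoD[OF lim eps])
    moreover have "\<forall>\<^sub>F n in sequentially. N + 1 \<le> n" by (rule eventually_ge_at_top)
    ultimately obtain n where n: "dist ((\<Sum>j<n. phi ((T ^^ j) x)) / real n) \<xi> < \<epsilon>" "N + 1 \<le> n"
      using eventually_happens'[OF sequentially_bot eventually_conj] by blast
    define w where "w = map (\<lambda>j. d1 ((T ^^ j) x)) [0..<n]"
    have sw: "(\<Sum>k\<leftarrow>w. ln (real k)) = (\<Sum>j<n. phi ((T ^^ j) x))"
      by (simp add: w_def phi_def o_def sum_list_sum_nth atLeast0LessThan)
    have "(\<Sum>j<n. phi ((T ^^ j) x)) - real n * \<xi> = real n * ((\<Sum>j<n. phi ((T ^^ j) x)) / real n - \<xi>)"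
      using n(2) by (simp add: right_diff_distrib)
    then have "\<bar>(\<Sum>j<n. phi ((T ^^ j) x)) - real n * \<xi>\<bar> = real n * \<bar>(\<Sum>j<n. phi ((T ^^ j) x)) / real n - \<xi>\<bar>"
      by (simp only: abs_mult abs_of_nat)
    also have "\<dots> \<le> real n * \<epsilon>" using n(1) by (intro mult_left_mono) (auto simp: dist_real_def)
    finally have "\<bar>(\<Sum>k\<leftarrow>w. ln (real k)) - real (length w) * \<xi>\<bar> \<le> real (length w) * \<epsilon>"
      unfolding sw by (simp add: w_def)
    moreover have "w \<in> words n" using d1_ge_1 by (auto simp: words_def w_def)
    ultimately have "w \<in> W" using n(2) by (simp add: W_def words_def)
    moreover have "x \<in> cyl w" using x01 by (simp add: cyl_def w_def)
    ultimately have "x \<in> U (to_nat w)" by (simp add: U_def)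
    then show "x \<in> (\<Union>i. U i)" by blast
  qed
  have sum_ge: "sum_list w \<ge> length w" if "w \<in> words (length w)" for w
    using that sum_list_mono[of w "\<lambda>_. 1" "\<lambda>k. k"] by (auto simp: words_def sum_list_triv)
  have small: "bounded (U i) \<and> diameter (U i) \<le> \<delta>" for i
  proof (cases "i \<in> to_nat ` W")
    case True
    then obtain w where w: "i = to_nat w" "w \<in> W" by blast
    have "(1/2::real) ^ sum_list w \<le> (1/2) ^ N"
      using w sum_ge[of w] by (intro power_decreasing) (auto simp: W_def)
    then have "diameter (cyl w) \<le> \<delta>" using diameter_cyl(2)[of w] N(2) by linarith
    then show ?thesis using diameter_cyl(1)[of w] w by (auto simp: U_def)
  qed (use \<delta> in \<open>auto simp: U_def\<close>)
  have tle: "diameter (cyl w) powr s \<le> prod_list (map g w)" if w: "w \<in> W" for w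
  proof -
    have wpos: "k \<ge> 1" if "k \<in> set w" for k using w that by (auto simp: W_def words_def)
    have "prod_list (map g v) = exp (q * (\<Sum>k\<leftarrow>v. ln (real k)) - real (sum_list v) * s * ln 2 + real (length v) * c)"
      if "\<forall>k\<in>set v. k \<ge> 1" for v
      using that
    proof (induction v)
      case (Cons a v)
      then have ga: "g a = exp (q * ln (real a) - real a * s * ln 2 + c)"
        by (simp add: g_def weight_eq_exp mult_exp_exp)
      have "prod_list (map g (a # v)) = g a * prod_list (map g v)" by simp
      also have "\<dots> = exp ((q * ln (real a) - real a * s * ln 2 + c) +
          (q * (\<Sum>k\<leftarrow>v. ln (real k)) - real (sum_list v) * s * ln 2 + real (length v) * c))"
        using Cons unfolding ga by (simp add: mult_exp_exp)
      also have "\<dots> = exp (q * (\<Sum>k\<leftarrow>a # v. ln (real k)) - real (sum_list (a # v)) * s * ln 2 + real (length (a # v)) * c)"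
        by (rule arg_cong[where f = exp]) (simp add: algebra_simps)
      finally show ?case .
    qed simp
    then have eq: "prod_list (map g w) = exp (q * (\<Sum>k\<leftarrow>w. ln (real k)) - real (sum_list w) * s * ln 2 + real (length w) * c)"
      using wpos by blast
    let ?D = "(\<Sum>k\<leftarrow>w. ln (real k)) - real (length w) * \<xi>"
    have "\<bar>q * ?D\<bar> \<le> \<bar>q\<bar> * (real (length w) * \<epsilon>)"
      unfolding abs_mult using w by (intro mult_left_mono) (auto simp: W_def)
    then have "0 \<le> q * ?D + \<bar>q\<bar> * (real (length w) * \<epsilon>)" by linarith
    moreover have "q * (\<Sum>k\<leftarrow>w. ln (real k)) - real (sum_list w) * s * ln 2 + real (length w) * c
        = - real (sum_list w) * s * ln 2 + (q * ?D + \<bar>q\<bar> * (real (length w) * \<epsilon>))"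
      by (simp add: c_def right_diff_distrib distrib_left mult.commute mult.left_commute)
    ultimately have "exp (- real (sum_list w) * s * ln 2) \<le> prod_list (map g w)"
      unfolding eq exp_le_cancel_iff by linarith
    moreover have "diameter (cyl w) powr s \<le> ((1/2) ^ sum_list w) powr s"
      using diameter_cyl[of w] s by (intro powr_mono2) (auto simp: diameter_ge_0)
    moreover have "((1/2) ^ sum_list w) powr s = exp (- real (sum_list w) * s * ln 2)"
      by (simp add: powr_def ln_realpow ln_div)
    ultimately show ?thesis by linarith
  qed
  have "(\<Sum>i. ennreal (diameter (U i) powr s)) \<le> ennreal e"
  proof (rule suminf_le_const)
    fix n
    let ?F = "{w \<in> W. to_nat w < n}"
    have finF: "finite ?F" by (rule finite_imageD[of to_nat]) (auto intro: finite_subset[of _ "{..<n}"])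
    have "(\<Sum>i<n. diameter (U i) powr s) = (\<Sum>i\<in>to_nat ` ?F. diameter (U i) powr s)"
      by (rule sum.mono_neutral_right) (auto simp: U_def diameter_def)
    also have "\<dots> = (\<Sum>w\<in>?F. diameter (cyl w) powr s)"
      by (subst sum.reindex) (auto simp: U_def intro!: sum.cong)
    also have "\<dots> \<le> (\<Sum>w\<in>?F. prod_list (map g w))" by (rule sum_mono) (use tle in auto)
    also have "\<dots> \<le> \<rho> ^ N / (1 - \<rho>)"
      by (rule wordweight_sum_le[OF g rho(2) finF]) (auto simp: W_def)
    finally show "(\<Sum>i<n. ennreal (diameter (U i) powr s)) \<le> ennreal e"
      using N by (subst sum_ennreal) (auto intro!: ennreal_leI)
  qed simp
  then show "hausdorff_approx s \<delta> (E_phi \<xi>) \<le> ennreal e"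
    unfolding hausdorff_approx_def using cover small by (intro INF_lower2[of U]) auto
qed

lemma hausdorff_dim_eqI:
  assumes "d \<ge> 0" "\<And>s. s > d \<Longrightarrow> hausdorff_measure s E = 0"
    and "\<And>s. 0 < s \<Longrightarrow> s < d \<Longrightarrow> hausdorff_measure s E \<noteq> 0"
  shows "hausdorff_dim E = d"
  unfolding hausdorff_dim_def
proof (rule cInf_eq)
  fix s assume "s \<in> {s. s > 0 \<and> hausdorff_measure s E = 0}"
  then show "d \<le> s" using assms(3)[of s] by force
next
  fix y assume y: "\<And>s. s \<in> {s. s > 0 \<and> hausdorff_measure s E = 0} \<Longrightarrow> y \<le> s"
  show "y \<le> d"
    by (rule dense_ge) (use assms y in auto)
qed

text \<open>At \<open>\<xi> = 0\<close> the covering criterion asks only for some \<open>q\<close>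
  with negative pressure, which exists for every \<open>s > 0\<close>.\<close>

lemma hausdorff_dim_E_phi_0: "hausdorff_dim (E_phi 0) = 0"
proof (rule hausdorff_dim_eqI)
  fix s :: real assume s: "s > 0"
  then obtain M where "press s (- M) < 0" using press_neg_exists by blast
  then show "hausdorff_measure s (E_phi 0) = 0"
    by (intro hausdorff_measure_E_phi_zero[OF s, of "- M"]) simp
qed auto

lemma hausdorff_measure_E_phi_above:
  assumes "\<xi> > 0" "s > tsol \<xi>"
  shows "hausdorff_measure s (E_phi \<xi>) = 0"
proof (rule hausdorff_measure_E_phi_zero[where q = "qsol \<xi>"])
  show "s > 0" using sol_props(1) assms by force
  show "press s (qsol \<xi>) < qsol \<xi> * \<xi>"
    using press_strict_antimono[of "tsol \<xi>" s "qsol \<xi>"] sol_props(1,2)[OF assms(1)] assms by simp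
qed

subsection \<open>Bernoulli measures and the strong law\<close>

abbreviation bern :: "nat pmf \<Rightarrow> (nat \<Rightarrow> nat) measure" where
  "bern p \<equiv> PiM UNIV (\<lambda>_::nat. measure_pmf p)"

lemma product_prob_space_pmf: "product_prob_space (\<lambda>_. measure_pmf p)"
  by (rule product_prob_spaceI) (rule measure_pmf.prob_space_axioms)

lemma space_bern [simp]: "space (bern p) = UNIV"
  by (simp add: space_PiM)

lemma prob_space_bern: "prob_space (bern p)"
  by (rule prob_space_PiM) (rule measure_pmf.prob_space_axioms)

lemma measurable_coordinate:
  fixes f :: "nat \<Rightarrow> 'a :: topological_space"
  shows "(\<lambda>x. f (x j)) \<in> borel_measurable (bern p)"
  by (rule measurable_compose[OF measurable_component_singleton]) auto

text \<open>These are the events that \<open>dyadic_interval_digits\<close> produces: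
  \<open>n\<close> fixed coordinates and a lower bound for the next one.\<close>

lemma bern_cylinder:
  fixes a :: "nat \<Rightarrow> nat" and n r :: nat
  defines "B \<equiv> {x. (\<forall>j<n. x j = a j) \<and> r \<le> x n}"
  shows "B \<in> sets (bern p)"
    and "emeasure (bern p) B = ennreal ((\<Prod>j<n. pmf p (a j)) * measure (measure_pmf p) {r..})"
proof -
  interpret product_prob_space "\<lambda>_. measure_pmf p" UNIV by (rule product_prob_space_pmf)
  let ?X = "\<lambda>j. if j < n then {a j} else {r..}"
  have B: "B = {x \<in> space (bern p). \<forall>j\<in>{..n}. x j \<in> ?X j}"
    by (auto simp: B_def less_Suc_eq_le[symmetric] less_Suc_eq)
  show "B \<in> sets (bern p)"
    unfolding B
  proof (rule sets.sets_Collect_finite_All)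
    fix j
    have "(\<lambda>x. x j) -` ?X j \<inter> space (bern p) \<in> sets (bern p)"
      by (rule measurable_sets[OF measurable_component_singleton]) auto
    then show "{x \<in> space (bern p). x j \<in> ?X j} \<in> sets (bern p)"
      by (simp add: vimage_def Int_def conj_commute)
  qed simp
  have "emeasure (bern p) B = (\<Prod>j\<in>{..n}. emeasure (measure_pmf p) (?X j))"
    unfolding B by (rule emeasure_PiM_Collect) auto
  also have "\<dots> = (\<Prod>j\<in>{..<n}. emeasure (measure_pmf p) (?X j)) * emeasure (measure_pmf p) (?X n)"
    by (simp add: lessThan_Suc_atMost[symmetric])
  also have "\<dots> = (\<Prod>j<n. ennreal (pmf p (a j))) * ennreal (measure (measure_pmf p) {r..})"
    by (simp add: emeasure_pmf_single measure_pmf.emeasure_eq_measure pmf.rep_eq)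
  also have "\<dots> = ennreal ((\<Prod>j<n. pmf p (a j)) * measure (measure_pmf p) {r..})"
    by (simp add: prod_ennreal ennreal_mult prod_nonneg)
  finally show "emeasure (bern p) B = ennreal ((\<Prod>j<n. pmf p (a j)) * measure (measure_pmf p) {r..})" .
qed

lemma bern_nn_integral_prod:
  fixes f :: "nat \<Rightarrow> ennreal"
  shows "(\<integral>\<^sup>+x. (\<Prod>j<n. f (x j)) \<partial>bern p) = (\<integral>\<^sup>+k. f k \<partial>measure_pmf p) ^ n"
proof -
  interpret product_prob_space "\<lambda>_. measure_pmf p" UNIV by (rule product_prob_space_pmf)
  let ?J = "PiM {..<n} (\<lambda>_. measure_pmf p)"
  have [measurable]: "(\<lambda>x. \<Prod>j<n. f (x j)) \<in> borel_measurable ?J"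
    by (intro borel_measurable_prod_ennreal measurable_compose[OF measurable_component_singleton]) auto
  have "(\<integral>\<^sup>+x. (\<Prod>j<n. f (x j)) \<partial>bern p) = (\<integral>\<^sup>+x. (\<Prod>j<n. f (restrict x {..<n} j)) \<partial>bern p)"
    by (intro nn_integral_cong prod.cong) auto
  also have "\<dots> = (\<integral>\<^sup>+x. (\<Prod>j<n. f (x j)) \<partial>distr (bern p) ?J (\<lambda>x. restrict x {..<n}))"
    by (subst nn_integral_distr) (auto intro: measurable_restrict_subset)
  also have "\<dots> = (\<integral>\<^sup>+x. (\<Prod>j<n. f (x j)) \<partial>?J)"
    by (subst distr_PiM_restrict_finite) auto
  also have "\<dots> = (\<Prod>j<n. \<integral>\<^sup>+k. f k \<partial>measure_pmf p)"
    by (rule product_nn_integral_prod) auto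
  finally show ?thesis by simp
qed

definition lnsum :: "nat \<Rightarrow> (nat \<Rightarrow> nat) \<Rightarrow> real" where
  "lnsum n x = (\<Sum>j<n. ln (real (Suc (x j))))"

lemma measurable_lnsum [measurable]: "lnsum n \<in> borel_measurable (bern p)"
  unfolding lnsum_def[abs_def] by (intro borel_measurable_sum measurable_coordinate)

text \<open>Exponential Markov inequality, where independence turns the moment into an
  \<open>n\<close>-th power. Allowing both signs of \<open>\<theta>\<close> treats both tails at
  once.\<close>

lemma bern_chernoff:
  "emeasure (bern p) {x. \<theta> * lnsum n x \<ge> c}
     \<le> ennreal (exp (- c)) * (\<integral>\<^sup>+k. ennreal (exp (\<theta> * ln (real (Suc k)))) \<partial>measure_pmf p) ^ n"
proof -
  have "emeasure (bern p) {x \<in> space (bern p). \<theta> * lnsum n x \<ge> c} \<le>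
      ennreal (exp (- 1 * c)) * (\<integral>\<^sup>+x. ennreal (exp (1 * (\<theta> * lnsum n x))) * indicator (space (bern p)) x \<partial>bern p)"
    by (rule Chernoff_ineq_nn_integral_ge) measurable
  also have "(\<integral>\<^sup>+x. ennreal (exp (1 * (\<theta> * lnsum n x))) * indicator (space (bern p)) x \<partial>bern p)
      = (\<integral>\<^sup>+x. (\<Prod>j<n. ennreal (exp (\<theta> * ln (real (Suc (x j)))))) \<partial>bern p)"
    by (intro nn_integral_cong) (simp add: lnsum_def sum_distrib_left exp_sum prod_ennreal del: of_nat_Suc)
  also have "\<dots> = (\<integral>\<^sup>+k. ennreal (exp (\<theta> * ln (real (Suc k)))) \<partial>measure_pmf p) ^ n"
    by (rule bern_nn_integral_prod)
  finally show ?thesis by simp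
qed

section \<open>The Gibbs measure of the solution and its law of large numbers\<close>

definition gibbs :: "real \<Rightarrow> nat pmf" where
  "gibbs \<xi> = embed_pmf (\<lambda>k. weight (tsol \<xi>) (qsol \<xi>) k * exp (- (qsol \<xi> * \<xi>)))"

text \<open>The first equation of the system says \<open>wsum 0\<close> equals
  \<open>exp (qsol \<xi> * \<xi>)\<close> at the solution, so the exponential factor is the right
  normalisation.\<close>

lemma pmf_gibbs:
  assumes "\<xi> > 0"
  shows "pmf (gibbs \<xi>) k = weight (tsol \<xi>) (qsol \<xi>) k * exp (- (qsol \<xi> * \<xi>))"
  unfolding gibbs_def
proof (rule pmf_embed_pmf)
  let ?t = "tsol \<xi>" and ?q = "qsol \<xi>"
  show nn: "0 \<le> weight ?t ?q k * exp (- (?q * \<xi>))" for k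
    by (simp add: weight_pos less_imp_le)
  have t: "?t > 0" using sol_props assms by blast
  have "wsum 0 ?t ?q = exp (?q * \<xi>)"
    using sol_props(2)[OF assms] wsum0_pos[OF t, of ?q] by (metis press_def exp_ln)
  then have "(\<lambda>k. weight ?t ?q k * exp (- (?q * \<xi>))) sums 1"
    using sums_mult2[OF summable_sums[OF summable_weight0[OF t, of ?q]], of "exp (- (?q * \<xi>))"]
    by (simp add: wsum_0_eq mult_exp_exp)
  then show "(\<integral>\<^sup>+k. ennreal (weight ?t ?q k * exp (- (?q * \<xi>))) \<partial>count_space UNIV) = 1"
    unfolding nn_integral_count_space_nat by (subst suminf_ennreal_eq[OF nn]) auto
qed

text \<open>Exponential tilting by \<open>\<theta>\<close> shifts the parameter \<open>q\<close> by
  \<open>\<theta>\<close>, so the moment generating function is a ratio of partition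
  functions.\<close>

lemma gibbs_nn_integral:
  assumes "\<xi> > 0"
  shows "(\<integral>\<^sup>+k. ennreal (exp (\<theta> * ln (real (Suc k)))) \<partial>measure_pmf (gibbs \<xi>))
    = ennreal (exp (press (tsol \<xi>) (qsol \<xi> + \<theta>) - qsol \<xi> * \<xi>))"
proof -
  let ?t = "tsol \<xi>" and ?q = "qsol \<xi>"
  have t: "?t > 0" using sol_props assms by blast
  have "(\<integral>\<^sup>+k. ennreal (exp (\<theta> * ln (real (Suc k)))) \<partial>measure_pmf (gibbs \<xi>))
     = (\<Sum>k. ennreal (weight ?t (?q + \<theta>) k * exp (- (?q * \<xi>))))"
    unfolding nn_integral_measure_pmf pmf_gibbs[OF assms] nn_integral_count_space_nat weight_add
    by (simp add: ennreal_mult[symmetric] weight_pos less_imp_le mult.assoc mult.commute mult.left_commute del: of_nat_Suc)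
  also have "\<dots> = ennreal (wsum 0 ?t (?q + \<theta>) * exp (- (?q * \<xi>)))"
    unfolding wsum_0_eq
    by (intro suminf_ennreal_eq sums_mult2 summable_sums summable_weight0[OF t]) (simp add: weight_pos less_imp_le)
  also have "wsum 0 ?t (?q + \<theta>) * exp (- (?q * \<xi>)) = exp (press ?t (?q + \<theta>) - ?q * \<xi>)"
    using wsum0_pos[OF t, of "?q + \<theta>"] by (simp add: press_def exp_diff exp_minus field_simps)
  finally show ?thesis .
qed

text \<open>First-order expansion of the pressure at \<open>qsol \<xi>\<close>, where its value is
  \<open>qsol \<xi> * \<xi>\<close> and its slope \<open>\<xi>\<close>; one step size
  \<open>h\<close> serves both signs.\<close>

lemma gibbs_slope:
  assumes "\<xi> > 0" "\<epsilon> > 0"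
  shows "\<exists>h>0. \<forall>\<theta>\<in>{h, - h}. press (tsol \<xi>) (qsol \<xi> + \<theta>) - qsol \<xi> * \<xi> < \<theta> * \<xi> + h * \<epsilon>"
proof -
  let ?t = "tsol \<xi>" and ?q = "qsol \<xi>"
  have t: "?t > 0" using sol_props assms by blast
  have "((\<lambda>h. (press ?t (?q + h) - press ?t ?q) / h) \<longlongrightarrow> \<xi>) (at 0)"
    using press_deriv_q[OF t, of ?q] sol_props(3)[OF assms(1)] by (simp add: DERIV_def)
  from tendstoD[OF this assms(2)] obtain d where d: "d > 0"
    "\<And>h. h \<noteq> 0 \<Longrightarrow> \<bar>h\<bar> < d \<Longrightarrow> \<bar>(press ?t (?q + h) - press ?t ?q) / h - \<xi>\<bar> < \<epsilon>"
    by (auto simp: eventually_at dist_real_def)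
  have "press ?t (?q + \<theta>) - ?q * \<xi> < \<theta> * \<xi> + d / 2 * \<epsilon>" if "\<theta> \<in> {d / 2, - (d / 2)}" for \<theta>
  proof -
    have th: "\<theta> \<noteq> 0" "\<bar>\<theta>\<bar> = d / 2" using that d(1) by auto
    then have "\<bar>(press ?t (?q + \<theta>) - press ?t ?q) / \<theta> - \<xi>\<bar> < \<epsilon>" using d by auto
    then have "\<bar>\<theta>\<bar> * \<bar>(press ?t (?q + \<theta>) - press ?t ?q) / \<theta> - \<xi>\<bar> < \<bar>\<theta>\<bar> * \<epsilon>"
      using th by (intro mult_strict_left_mono) auto
    moreover have "\<theta> * ((press ?t (?q + \<theta>) - press ?t ?q) / \<theta> - \<xi>) = press ?t (?q + \<theta>) - press ?t ?q - \<theta> * \<xi>"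
      using th(1) by (simp add: field_simps)
    ultimately have "\<bar>press ?t (?q + \<theta>) - press ?t ?q - \<theta> * \<xi>\<bar> < \<bar>\<theta>\<bar> * \<epsilon>"
      by (simp only: abs_mult[symmetric])
    then show ?thesis using sol_props(2)[OF assms(1)] unfolding th(2) by linarith
  qed
  then show ?thesis using d(1) by (intro exI[of _ "d / 2"]) auto
qed

lemma gibbs_one_sided:
  assumes "\<xi> > 0"
    and lt: "press (tsol \<xi>) (qsol \<xi> + \<theta>) - qsol \<xi> * \<xi> < \<theta> * \<xi> + h * \<epsilon>"
  shows "AE x in bern (gibbs \<xi>). \<forall>\<^sub>F n in sequentially. \<theta> * lnsum n x < real n * (\<theta> * \<xi> + h * \<epsilon>)"
proof -
  let ?M = "bern (gibbs \<xi>)"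
  define A where "A = (\<lambda>n. {x. \<theta> * lnsum n x \<ge> real n * (\<theta> * \<xi> + h * \<epsilon>)})"
  \<comment> \<open>The Chernoff factor per digit; \<open>lt\<close> states exactly that it is below
    1, which makes the bad events summable.\<close>
  define \<kappa> where "\<kappa> = exp (press (tsol \<xi>) (qsol \<xi> + \<theta>) - qsol \<xi> * \<xi> - (\<theta> * \<xi> + h * \<epsilon>))"
  have k: "0 < \<kappa>" "\<kappa> < 1" using lt by (auto simp: \<kappa>_def)
  interpret prob_space ?M by (rule prob_space_bern)
  have Am: "A n \<in> sets ?M" for n
  proof -
    have "{x \<in> space ?M. \<theta> * lnsum n x \<ge> real n * (\<theta> * \<xi> + h * \<epsilon>)} \<in> sets ?M" by measurable
    then show ?thesis by (simp add: A_def)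
  qed
  have Ale: "emeasure ?M (A n) \<le> ennreal (\<kappa> ^ n)" for n
  proof -
    have "emeasure ?M (A n) \<le> ennreal (exp (- (real n * (\<theta> * \<xi> + h * \<epsilon>)))) *
        ennreal (exp (press (tsol \<xi>) (qsol \<xi> + \<theta>) - qsol \<xi> * \<xi>)) ^ n"
      using bern_chernoff[of "gibbs \<xi>" "real n * (\<theta> * \<xi> + h * \<epsilon>)" \<theta> n]
      unfolding gibbs_nn_integral[OF assms(1)] A_def .
    also have "\<dots> = ennreal (exp (- (real n * (\<theta> * \<xi> + h * \<epsilon>))) * exp (press (tsol \<xi>) (qsol \<xi> + \<theta>) - qsol \<xi> * \<xi>) ^ n)"
      by (simp add: ennreal_mult ennreal_power)
    also have "exp (- (real n * (\<theta> * \<xi> + h * \<epsilon>))) * exp (press (tsol \<xi>) (qsol \<xi> + \<theta>) - qsol \<xi> * \<xi>) ^ n = \<kappa> ^ n"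
      unfolding \<kappa>_def exp_of_nat_mult[symmetric] mult_exp_exp by (simp add: algebra_simps)
    finally show ?thesis .
  qed
  have "measure ?M (A n) \<le> \<kappa> ^ n" for n
    using Ale[of n] k by (simp add: emeasure_eq_measure)
  then have "summable (\<lambda>n. measure ?M (A n))"
    using k by (intro summable_comparison_test'[OF summable_geometric[of \<kappa>]]) auto
  then have "AE x in ?M. \<forall>\<^sub>F n in sequentially. x \<in> space ?M - A n"
    using Am by (intro borel_cantelli_AE1) (auto simp: emeasure_eq_measure)
  then show ?thesis
    by eventually_elim (auto simp: A_def not_le elim!: eventually_mono)
qed

lemma gibbs_strong_law:
  assumes "\<xi> > 0"
  shows "AE x in bern (gibbs \<xi>). (\<lambda>n. lnsum n x / real n) \<longlonglongrightarrow> \<xi>"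
proof -
  have ev: "AE x in bern (gibbs \<xi>). \<forall>\<^sub>F n in sequentially. \<bar>lnsum n x - real n * \<xi>\<bar> < real n * \<epsilon>" if e: "\<epsilon> > 0" for \<epsilon>
  proof -
    obtain h where h: "h > 0" "\<forall>\<theta>\<in>{h, - h}. press (tsol \<xi>) (qsol \<xi> + \<theta>) - qsol \<xi> * \<xi> < \<theta> * \<xi> + h * \<epsilon>"
      using gibbs_slope[OF assms e] by blast
    have "AE x in bern (gibbs \<xi>). \<forall>\<^sub>F n in sequentially. h * lnsum n x < real n * (h * \<xi> + h * \<epsilon>)"
      "AE x in bern (gibbs \<xi>). \<forall>\<^sub>F n in sequentially. - h * lnsum n x < real n * (- h * \<xi> + h * \<epsilon>)"
      using gibbs_one_sided[OF assms, of h h \<epsilon>] gibbs_one_sided[OF assms, of "- h" h \<epsilon>] h(2) by auto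
    then show ?thesis
    proof eventually_elim
      case (elim x)
      then show ?case
      proof eventually_elim
        case (elim n)
        have "h * lnsum n x < h * (real n * \<xi> + real n * \<epsilon>)" "h * (real n * \<xi> - real n * \<epsilon>) < h * lnsum n x"
          using elim by (simp_all add: algebra_simps)
        then have "lnsum n x < real n * \<xi> + real n * \<epsilon>" "real n * \<xi> - real n * \<epsilon> < lnsum n x"
          using h(1) by simp_all
        then show ?case by (simp add: abs_less_iff)
      qed
    qed
  qed
  \<comment> \<open>Countably many tolerances suffice, so the exceptional null sets can be
    united.\<close>
  have "AE x in bern (gibbs \<xi>). \<forall>m. \<forall>\<^sub>F n in sequentially. \<bar>lnsum n x - real n * \<xi>\<bar> < real n * (1 / real (Suc m))"
    unfolding AE_all_countable by (rule allI, rule ev) simp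
  then show ?thesis
  proof eventually_elim
    case (elim x)
    show ?case
    proof (rule tendstoI)
      fix e :: real assume "e > 0"
      then obtain m where m: "1 / real (Suc m) < e" using reals_Archimedean by (auto simp: inverse_eq_divide)
      from elim have "\<forall>\<^sub>F n in sequentially. \<bar>lnsum n x - real n * \<xi>\<bar> < real n * (1 / real (Suc m))" by blast
      moreover have "\<forall>\<^sub>F n::nat in sequentially. n > 0" by (rule eventually_gt_at_top)
      ultimately show "\<forall>\<^sub>F n in sequentially. dist (lnsum n x / real n) \<xi> < e"
      proof eventually_elim
        case (elim n)
        have "real n * \<bar>lnsum n x / real n - \<xi>\<bar> = \<bar>real n * (lnsum n x / real n - \<xi>)\<bar>" by (simp add: abs_mult)
        also have "\<dots> = \<bar>lnsum n x - real n * \<xi>\<bar>" using elim by (simp add: right_diff_distrib)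
        finally have "real n * \<bar>lnsum n x / real n - \<xi>\<bar> < real n * e"
          using elim m by (smt (verit) mult_left_mono of_nat_0_le_iff)
        then show ?case using elim by (simp add: dist_real_def)
      qed
    qed
  qed
qed

subsection \<open>Lower bound for the dimension\<close>

lemma code_mem_E_phi:
  "code x \<in> E_phi \<xi> \<longleftrightarrow> (\<lambda>n. lnsum n x / real n) \<longlonglongrightarrow> \<xi>"
  using code_bounds[of x] by (simp add: E_phi_def phi_def digit_code lnsum_def)

lemma code_lower: "(1/2) ^ Suc (a 0) < code a" and code_upper: "code a \<le> (1/2) ^ a 0"
  using code_rec[of a] code_bounds[of "\<lambda>n. a (Suc n)"] by (simp_all add: power_one_over field_simps)

text \<open>A dyadic interval of level \<open>m\<close> meeting the \<open>n\<close>-cylinder of \<open>a\<close> prescribes the \<open>n\<close> complete digits of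
  \<open>a\<close> and a lower bound for the digit that crosses level \<open>m\<close>.\<close>

lemma dyadic_interval_digits:
  assumes "\<lceil>2 ^ m * code a\<rceil> = \<lceil>2 ^ m * code b\<rceil>"
    and "(\<Sum>j<n. Suc (a j)) \<le> m" "m < (\<Sum>j<Suc n. Suc (a j))"
  shows "(\<forall>j<n. b j = a j) \<and> m - (\<Sum>j<n. Suc (a j)) \<le> b n"
  using assms
proof (induction n arbitrary: a b m)
  case 0
  then have "m \<le> a 0" by simp
  then have "2 ^ m * code a \<le> 2 ^ a 0 * (1/2) ^ a 0"
    using code_bounds[of a] by (intro mult_mono code_upper power_increasing) auto
  then have "2 ^ m * code a \<le> 1" by (simp add: power_one_over)
  \<comment> \<open>Both points lie in the first dyadic interval (0, 2^(-m)], so the first digit of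
    \<open>b\<close> must exceed \<open>m\<close>. Ceilings are used because the intervals are open
    on the left.\<close>
  then have "\<lceil>2 ^ m * code a\<rceil> \<le> 1" by simp
  then have "\<lceil>2 ^ m * code b\<rceil> \<le> 1" unfolding 0(1) .
  then have "2 ^ m * code b \<le> 1" by simp
  moreover have "2 ^ m * (1/2) ^ Suc (b 0) < 2 ^ m * code b"
    by (rule mult_strict_left_mono[OF code_lower]) simp
  ultimately have "2 ^ m * (1/2) ^ Suc (b 0) < (1::real)" by linarith
  then have "(2::real) ^ m < 2 ^ Suc (b 0)" by (simp add: power_one_over field_simps)
  then show ?case by (simp add: power_strict_increasing_iff del: power_Suc)
next
  case (Suc n)
  let ?a = "\<lambda>n. a (Suc n)" and ?b = "\<lambda>n. b (Suc n)"
  define A where "A = Suc (a 0)"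
  have s: "(\<Sum>j<Suc n. Suc (a j)) = A + (\<Sum>j<n. Suc (?a j))" for n
    by (simp only: sum.lessThan_Suc_shift A_def)
  obtain l where l: "m = A + l" using Suc.prems(2) s[of n] by (metis add.assoc le_Suc_ex)
  \<comment> \<open>Removing a first digit equal to \<open>A\<close> maps the dyadic intervals of
    level \<open>m\<close> in its branch onto those of level \<open>l = m - A\<close>, with index
    shifted by \<open>2 ^ l\<close>.\<close>
  have ceilA: "\<lceil>2 ^ m * code x\<rceil> = 2 ^ l + \<lceil>2 ^ l * code (\<lambda>n. x (Suc n))\<rceil>" if "Suc (x 0) = A" for x
  proof -
    have "2 ^ m * code x = 2 ^ l * code (\<lambda>n. x (Suc n)) + of_int (2 ^ l)"
      by (subst code_rec) (simp add: that l power_add field_simps del: power_Suc)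
    then show ?thesis by (simp only: ceiling_add_of_int)
  qed
  define N where "N = \<lceil>2 ^ l * code ?a\<rceil>"
  \<comment> \<open>These bounds place \<open>code b\<close> in the same first branch (2^(-A),
    2^(1-A)] as \<open>code a\<close>, which forces equal first digits.\<close>
  have N: "1 \<le> N" "N \<le> 2 ^ l"
    using code_bounds[of ?a] by (simp_all add: N_def ceiling_le_iff less_ceiling_iff[symmetric] int_one_le_iff_zero_less)
  have cb: "\<lceil>2 ^ m * code b\<rceil> = 2 ^ l + N" using Suc.prems(1) ceilA[of a] by (simp add: A_def N_def)
  have up: "2 ^ m * code b \<le> 2 * 2 ^ l"
  proof -
    have "2 ^ m * code b \<le> of_int (2 ^ l + N)" using cb by (metis le_of_int_ceiling)
    also have "\<dots> \<le> of_int (2 ^ l + 2 ^ l)" using N by (simp only: of_int_le_iff)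
    finally show ?thesis by simp
  qed
  have lo: "2 ^ l < 2 ^ m * code b"
  proof -
    have "of_int (2 ^ l) \<le> (of_int (2 ^ l + N - 1) :: real)" using N by (simp only: of_int_le_iff)
    also have "\<dots> < 2 ^ m * code b" using cb by linarith
    finally show ?thesis by simp
  qed
  have "a 0 \<le> b 0"
  proof -
    have "2 ^ m * (1/2) ^ Suc (b 0) < 2 ^ m * code b"
      by (rule mult_strict_left_mono[OF code_lower]) simp
    then have "2 ^ m * (1/2) ^ Suc (b 0) < (2 * 2 ^ l :: real)" using up by linarith
    then have "(2::real) ^ a 0 < 2 ^ Suc (b 0)"
      by (simp add: l A_def power_add power_one_over field_simps)
    then show ?thesis by (simp add: power_strict_increasing_iff del: power_Suc)
  qed
  moreover have "b 0 \<le> a 0"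
  proof -
    have "2 ^ m * code b \<le> 2 ^ m * (1/2) ^ b 0"
      by (rule mult_left_mono[OF code_upper]) simp
    then have "2 ^ l < (2 ^ m * (1/2) ^ b 0 :: real)" using lo by linarith
    then have "(2::real) ^ b 0 < 2 ^ Suc (a 0)"
      by (simp add: l A_def power_add power_one_over field_simps)
    then show ?thesis by (simp add: power_strict_increasing_iff del: power_Suc)
  qed
  ultimately have b0: "b 0 = a 0" by simp
  have "\<lceil>2 ^ l * code ?a\<rceil> = \<lceil>2 ^ l * code ?b\<rceil>"
    using Suc.prems(1) ceilA[of a] ceilA[of b] b0 by (simp add: A_def)
  moreover have "(\<Sum>j<n. Suc (?a j)) \<le> l" "l < (\<Sum>j<Suc n. Suc (?a j))"
    using Suc.prems(2,3) unfolding s l by auto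
  ultimately have IH: "(\<forall>j<n. ?b j = ?a j) \<and> l - (\<Sum>j<n. Suc (?a j)) \<le> ?b n"
    by (rule Suc.IH)
  then show ?case unfolding s l using b0 by (auto simp: less_Suc_eq_0_disj)
qed

lemma level_exists:
  fixes a :: "nat \<Rightarrow> nat"
  shows "\<exists>n. (\<Sum>j<n. Suc (a j)) \<le> m \<and> m < (\<Sum>j<Suc n. Suc (a j))"
proof -
  let ?P = "\<lambda>n. m < (\<Sum>j<Suc n. Suc (a j))"
  have ge: "n \<le> (\<Sum>j<n. Suc (a j))" for n by (induction n) auto
  have "?P m" using ge[of "Suc m"] by simp
  then have P: "?P (LEAST n. ?P n)" by (rule LeastI)
  moreover have "(\<Sum>j<(LEAST n. ?P n). Suc (a j)) \<le> m"
  proof (cases "LEAST n. ?P n")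
    case (Suc k)
    then have "\<not> ?P k" using not_less_Least[of k ?P] by simp
    then show ?thesis using Suc by simp
  qed simp
  ultimately show ?thesis by blast
qed

text \<open>The additive constant \<open>K\<close> makes the mass bounds uniform in \<open>n\<close>.\<close>

definition controlled :: "real \<Rightarrow> real \<Rightarrow> real \<Rightarrow> (nat \<Rightarrow> nat) set" where
  "controlled \<xi> \<epsilon> K = {x. \<forall>n. \<bar>lnsum n x - real n * \<xi>\<bar> \<le> real n * \<epsilon> + K}"

context
  fixes \<xi> s \<epsilon> K :: real
  assumes xi: "\<xi> > 0" and s: "0 < s" "s < tsol \<xi>"
    and eps: "\<bar>qsol \<xi>\<bar> * \<epsilon> \<le> (tsol \<xi> - s) * ln 2"
begin

text \<open>Product of the constants in \<open>gibbs_cylinder_mass\<close> and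
  \<open>gibbs_tail\<close>.\<close>

definition mass_const :: real where
  "mass_const = exp (\<bar>qsol \<xi>\<bar> * K) * (wsum 0 (tsol \<xi> - s) (qsol \<xi>) * exp (- (qsol \<xi> * \<xi>)))"

lemma mass_const_pos: "mass_const > 0"
  unfolding mass_const_def using wsum0_pos[of "tsol \<xi> - s"] s by simp

text \<open>Split the decay 2^(-k t) into 2^(-k s) and 2^(-k (t-s)). The first factor is at most its
  value at \<open>r\<close>, and the second still gives a convergent series since
  \<open>s < tsol \<xi>\<close>.\<close>

lemma gibbs_tail:
  "measure (measure_pmf (gibbs \<xi>)) {r..} \<le> 2 powr (- real r * s) * (wsum 0 (tsol \<xi> - s) (qsol \<xi>) * exp (- (qsol \<xi> * \<xi>)))"
proof -
  let ?t = "tsol \<xi>" and ?q = "qsol \<xi>"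
  let ?u = "\<lambda>k. 2 powr (- real r * s) * (weight (?t - s) ?q k * exp (- (?q * \<xi>)))"
  have le: "pmf (gibbs \<xi>) k \<le> ?u k" if "r \<le> k" for k
  proof -
    have "weight ?t ?q k = 2 powr (- real (Suc k) * s) * weight (?t - s) ?q k"
      by (simp add: weight_def powr_add[symmetric] algebra_simps)
    also have "\<dots> \<le> 2 powr (- real r * s) * weight (?t - s) ?q k"
      using that s by (intro mult_right_mono powr_mono) (auto simp: weight_pos less_imp_le mult_right_mono)
    finally show ?thesis unfolding pmf_gibbs[OF xi] by simp
  qed
  have "emeasure (measure_pmf (gibbs \<xi>)) {r..} = (\<integral>\<^sup>+k. indicator {r..} k \<partial>measure_pmf (gibbs \<xi>))" by simp
  also have "\<dots> = (\<Sum>k. ennreal (pmf (gibbs \<xi>) k) * indicator {r..} k)"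
    by (simp only: nn_integral_measure_pmf nn_integral_count_space_nat)
  also have "\<dots> \<le> (\<Sum>k. ennreal (?u k))"
    using le by (intro suminf_le) (auto split: split_indicator intro!: ennreal_leI)
  also have "\<dots> = ennreal (2 powr (- real r * s) * (wsum 0 (?t - s) ?q * exp (- (?q * \<xi>))))"
    unfolding wsum_0_eq using s
    by (intro suminf_ennreal_eq sums_mult sums_mult2 summable_sums summable_weight0) (auto simp: weight_pos less_imp_le)
  finally show ?thesis
    using wsum0_pos[of "?t - s" ?q] s by (simp add: measure_pmf.emeasure_eq_measure)
qed

text \<open>On a controlled sequence the deviation costs at most
  \<open>\<bar>qsol \<xi>\<bar> * (n * \<epsilon> + K)\<close> in the exponent. As every digit is at
  least 1, \<open>n\<close> is at most the digit sum, so \<open>eps\<close> pays for the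
  \<open>\<epsilon>\<close> part by lowering the exponent from \<open>tsol \<xi>\<close> to
  \<open>s\<close>.\<close>

lemma gibbs_cylinder_mass:
  assumes "a \<in> controlled \<xi> \<epsilon> K"
  shows "(\<Prod>j<n. pmf (gibbs \<xi>) (a j)) \<le> exp (\<bar>qsol \<xi>\<bar> * K) * 2 powr (- real (\<Sum>j<n. Suc (a j)) * s)"
proof -
  let ?t = "tsol \<xi>" and ?q = "qsol \<xi>" and ?S = "real (\<Sum>j<n. Suc (a j))"
  have "(\<Prod>j<n. pmf (gibbs \<xi>) (a j)) = (\<Prod>j<n. exp (?q * ln (real (Suc (a j))) - real (Suc (a j)) * ?t * ln 2 + - (?q * \<xi>)))"
    by (simp only: pmf_gibbs[OF xi] weight_eq_exp mult_exp_exp)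
  also have "\<dots> = exp (\<Sum>j<n. ?q * ln (real (Suc (a j))) - real (Suc (a j)) * ?t * ln 2 + - (?q * \<xi>))"
    by (simp add: exp_sum)
  also have "(\<Sum>j<n. ?q * ln (real (Suc (a j))) - real (Suc (a j)) * ?t * ln 2 + - (?q * \<xi>))
      = ?q * (lnsum n a - real n * \<xi>) - ?S * ?t * ln 2"
    unfolding lnsum_def of_nat_sum
    by (simp add: sum.distrib sum_subtractf sum_distrib_left sum_distrib_right algebra_simps del: of_nat_Suc)
  also have "?q * (lnsum n a - real n * \<xi>) \<le> \<bar>?q\<bar> * (real n * \<epsilon> + K)"
  proof -
    have "\<bar>?q * (lnsum n a - real n * \<xi>)\<bar> \<le> \<bar>?q\<bar> * (real n * \<epsilon> + K)"
      unfolding abs_mult using assms by (intro mult_left_mono) (auto simp: controlled_def)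
    then show ?thesis by linarith
  qed
  also have "\<bar>?q\<bar> * (real n * \<epsilon> + K) \<le> \<bar>?q\<bar> * K + ?S * ((?t - s) * ln 2)"
  proof -
    have "n \<le> (\<Sum>j<n. Suc (a j))" by (induction n) auto
    then have "real n * (\<bar>?q\<bar> * \<epsilon>) \<le> ?S * ((?t - s) * ln 2)"
      using eps s by (intro order.trans[OF mult_left_mono[OF eps] mult_right_mono]) (auto simp del: of_nat_sum)
    then show ?thesis by (simp add: algebra_simps)
  qed
  finally have "(\<Prod>j<n. pmf (gibbs \<xi>) (a j)) \<le> exp (\<bar>?q\<bar> * K + ?S * ((?t - s) * ln 2) - ?S * ?t * ln 2)"
    by simp
  also have "\<dots> = exp (\<bar>?q\<bar> * K) * 2 powr (- ?S * s)"
    by (simp add: powr_def mult_exp_exp algebra_simps)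
  finally show ?thesis .
qed

text \<open>Completed digits give the scale \<open>S\<close>, the crossing digit gives
  \<open>m - S\<close>, and the two mass bounds multiply to the scale \<open>m\<close>. Measurable
  supersets are used because the sets \<open>V\<close> in the following lemmas are arbitrary and
  their preimages may fail to be measurable.\<close>

lemma dyadic_mass:
  "\<exists>B\<in>sets (bern (gibbs \<xi>)). {x \<in> controlled \<xi> \<epsilon> K. \<lceil>2 ^ m * code x\<rceil> = c} \<subseteq> B \<and>
     emeasure (bern (gibbs \<xi>)) B \<le> ennreal (mass_const * 2 powr (- real m * s))"
proof (cases "{x \<in> controlled \<xi> \<epsilon> K. \<lceil>2 ^ m * code x\<rceil> = c} = {}")
  case False
  then obtain a where a: "a \<in> controlled \<xi> \<epsilon> K" "\<lceil>2 ^ m * code a\<rceil> = c" by blast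
  obtain n where n: "(\<Sum>j<n. Suc (a j)) \<le> m" "m < (\<Sum>j<Suc n. Suc (a j))" using level_exists by blast
  define S where "S = (\<Sum>j<n. Suc (a j))"
  let ?B = "{x. (\<forall>j<n. x j = a j) \<and> m - S \<le> x n}"
  have "x \<in> ?B" if "\<lceil>2 ^ m * code x\<rceil> = c" for x
    using dyadic_interval_digits[of m a x n] n a that by (simp add: S_def)
  moreover have "emeasure (bern (gibbs \<xi>)) ?B \<le> ennreal (mass_const * 2 powr (- real m * s))"
  proof -
    let ?D = "wsum 0 (tsol \<xi> - s) (qsol \<xi>) * exp (- (qsol \<xi> * \<xi>))"
    have "(\<Prod>j<n. pmf (gibbs \<xi>) (a j)) * measure (measure_pmf (gibbs \<xi>)) {m - S..}
        \<le> (exp (\<bar>qsol \<xi>\<bar> * K) * 2 powr (- real S * s)) * (2 powr (- real (m - S) * s) * ?D)"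
      using gibbs_cylinder_mass[OF a(1), of n] gibbs_tail[of "m - S"] unfolding S_def[symmetric]
      by (intro mult_mono) (auto intro: prod_nonneg)
    also have "\<dots> = mass_const * (2 powr (- real S * s) * 2 powr (- real (m - S) * s))"
      by (simp add: mass_const_def)
    also have "2 powr (- real S * s) * 2 powr (- real (m - S) * s) = 2 powr (- real m * s)"
      using n(1) by (simp add: S_def[symmetric] powr_add[symmetric] of_nat_diff algebra_simps)
    finally show ?thesis unfolding bern_cylinder(2) by (rule ennreal_leI)
  qed
  ultimately show ?thesis using bern_cylinder(1)[of n a "m - S"] by blast
qed (auto intro!: bexI[of _ "{}"])

text \<open>A set of diameter at most 2^(-m) meets at most three consecutive dyadic intervals of
  level \<open>m\<close>, whence the constant 3.\<close>

lemma short_set_mass: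
  assumes V: "bounded V" "diameter V \<le> (1/2) ^ m"
  shows "\<exists>B\<in>sets (bern (gibbs \<xi>)). {x \<in> controlled \<xi> \<epsilon> K. code x \<in> V} \<subseteq> B \<and>
     emeasure (bern (gibbs \<xi>)) B \<le> ennreal (3 * mass_const * 2 powr (- real m * s))"
proof (cases "{x \<in> controlled \<xi> \<epsilon> K. code x \<in> V} = {}")
  case False
  let ?M = "bern (gibbs \<xi>)" and ?e = "mass_const * 2 powr (- real m * s)"
  from False obtain a where a: "code a \<in> V" by blast
  define c where "c = \<lceil>2 ^ m * code a\<rceil>"
  have near: "\<lceil>2 ^ m * code x\<rceil> \<in> {c - 1, c, c + 1}" if "code x \<in> V" for x
  proof -
    have "\<bar>code x - code a\<bar> \<le> (1/2) ^ m"
      using diameter_bounded_bound[OF V(1) that a] V(2) by (simp add: dist_real_def)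
    then have "2 ^ m * \<bar>code x - code a\<bar> \<le> 1" by (simp add: power_one_over field_simps)
    then have "\<bar>2 ^ m * code x - 2 ^ m * code a\<bar> \<le> 1" by (simp add: abs_mult right_diff_distrib[symmetric])
    then have "\<lceil>2 ^ m * code x\<rceil> \<le> c + 1" "c \<le> \<lceil>2 ^ m * code x\<rceil> + 1" unfolding c_def by linarith+
    then show ?thesis by auto
  qed
  have "\<forall>d. \<exists>B. B \<in> sets ?M \<and> {x \<in> controlled \<xi> \<epsilon> K. \<lceil>2 ^ m * code x\<rceil> = d} \<subseteq> B \<and>
      emeasure ?M B \<le> ennreal ?e"
    using dyadic_mass[of m] unfolding Bex_def by (rule allI)
  from choice[OF this] obtain B where B: "\<And>d. B d \<in> sets ?M"
    "\<And>d. {x \<in> controlled \<xi> \<epsilon> K. \<lceil>2 ^ m * code x\<rceil> = d} \<subseteq> B d"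
    "\<And>d. emeasure ?M (B d) \<le> ennreal ?e"
    by blast
  let ?B = "B (c - 1) \<union> B c \<union> B (c + 1)"
  have "emeasure ?M ?B \<le> emeasure ?M (B (c - 1) \<union> B c) + emeasure ?M (B (c + 1))"
    using B(1) by (intro emeasure_subadditive) auto
  also have "\<dots> \<le> (emeasure ?M (B (c - 1)) + emeasure ?M (B c)) + emeasure ?M (B (c + 1))"
    using B(1) by (intro add_right_mono emeasure_subadditive) auto
  also have "\<dots> \<le> (ennreal ?e + ennreal ?e) + ennreal ?e"
    by (intro add_mono B(3))
  also have "\<dots> = ennreal (3 * mass_const * 2 powr (- real m * s))"
    using mass_const_pos by (simp add: ennreal_plus[symmetric] del: ennreal_plus)
  finally have "emeasure ?M ?B \<le> ennreal (3 * mass_const * 2 powr (- real m * s))" .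
  moreover have "{x \<in> controlled \<xi> \<epsilon> K. code x \<in> V} \<subseteq> ?B"
    using near B(2) by blast
  ultimately show ?thesis using B(1) by (intro bexI[of _ ?B]) auto
qed (auto intro!: bexI[of _ "{}"])

lemma set_mass:
  assumes V: "bounded V" "diameter V \<le> 1"
  shows "\<exists>B\<in>sets (bern (gibbs \<xi>)). {x \<in> controlled \<xi> \<epsilon> K. code x \<in> V} \<subseteq> B \<and>
     emeasure (bern (gibbs \<xi>)) B \<le> ennreal (3 * mass_const * 2 powr s * diameter V powr s)"
proof (cases "diameter V = 0")
  case True
  let ?M = "bern (gibbs \<xi>)"
  have "\<exists>B\<in>sets ?M. {x \<in> controlled \<xi> \<epsilon> K. code x \<in> V} \<subseteq> B \<and>
     emeasure ?M B \<le> ennreal (3 * mass_const * 2 powr (- real m * s))" for m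
    by (rule short_set_mass) (use V True in auto)
  then have "\<forall>m. \<exists>B. B \<in> sets ?M \<and> {x \<in> controlled \<xi> \<epsilon> K. code x \<in> V} \<subseteq> B \<and>
     emeasure ?M B \<le> ennreal (3 * mass_const * 2 powr (- real m * s))"
    unfolding Bex_def by (rule allI)
  from choice[OF this] obtain B where B: "\<And>m. B m \<in> sets ?M" "\<And>m. {x \<in> controlled \<xi> \<epsilon> K. code x \<in> V} \<subseteq> B m"
    "\<And>m. emeasure ?M (B m) \<le> ennreal (3 * mass_const * 2 powr (- real m * s))"
    by blast
  \<comment> \<open>A set of diameter 0 admits the previous bound at every level; the intersection
    of the supersets has mass 0, matching \<open>0 powr s = 0\<close>.\<close>
  let ?B = "\<Inter>m. B m"
  have Bs: "?B \<in> sets ?M" using B(1) by blast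
  have "(\<lambda>m. 3 * mass_const * 2 powr (- real m * s)) \<longlonglongrightarrow> 3 * mass_const * 0"
    using s by (intro tendsto_mult tendsto_const) real_asymp
  then have "(\<lambda>m. ennreal (3 * mass_const * 2 powr (- real m * s))) \<longlonglongrightarrow> ennreal 0"
    by (intro tendsto_ennrealI) simp
  moreover have "emeasure ?M ?B \<le> ennreal (3 * mass_const * 2 powr (- real m * s))" for m
    by (rule order.trans[OF emeasure_mono B(3)[of m]]) (use B in auto)
  ultimately have "emeasure ?M ?B \<le> ennreal 0"
    by (intro LIMSEQ_le_const) auto
  then show ?thesis using Bs B(2) True by (intro bexI[of _ ?B]) auto
next
  case False
  then have d: "0 < diameter V" using diameter_ge_0[OF V(1)] by simp
  \<comment> \<open>The least such \<open>m\<close> gives 2^(-m-1) < diameter \<le> 2^(-m), using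
    diameter \<le> 1 when \<open>m = 0\<close>. Passing from 2^(-m) to the diameter costs the factor
    \<open>2 powr s\<close>.\<close>
  let ?P = "\<lambda>m. (1/2) ^ Suc m < diameter V"
  obtain k where "(1/2) ^ k < diameter V" using real_arch_pow_inv[OF d, of "1/2"] by auto
  then have "?P k" by (rule le_less_trans[rotated]) simp
  then have P: "?P (LEAST m. ?P m)" by (rule LeastI)
  define m where "m = (LEAST m. ?P m)"
  have dm: "diameter V \<le> (1/2) ^ m"
  proof (cases m)
    case (Suc l)
    then show ?thesis using not_less_Least[of l ?P] by (simp add: m_def not_less)
  qed (use V in simp)
  have "2 powr (- real m * s) = ((1/2) ^ m) powr s"
    by (simp add: powr_def ln_realpow ln_div)
  also have "\<dots> \<le> (2 * diameter V) powr s"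
    using P s by (intro powr_mono2) (auto simp: m_def)
  also have "\<dots> = 2 powr s * diameter V powr s" using d by (simp add: powr_mult)
  finally have "3 * mass_const * 2 powr (- real m * s) \<le> 3 * mass_const * 2 powr s * diameter V powr s"
    using mass_const_pos by (simp add: mult.assoc)
  then have le: "ennreal (3 * mass_const * 2 powr (- real m * s)) \<le> ennreal (3 * mass_const * 2 powr s * diameter V powr s)"
    by (rule ennreal_leI)
  from short_set_mass[OF V(1) dm] show ?thesis
  proof (elim bexE conjE, intro bexI conjI)
    fix B assume "emeasure (bern (gibbs \<xi>)) B \<le> ennreal (3 * mass_const * 2 powr (- real m * s))"
    then show "emeasure (bern (gibbs \<xi>)) B \<le> ennreal (3 * mass_const * 2 powr s * diameter V powr s)"
      using le by (rule order.trans)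
  qed
qed

end

text \<open>Vanishing measure would give covers with arbitrarily small \<open>s\<close>-sums and
  hence, by \<open>set_mass\<close>, make every controlled set null. By the strong law countably
  many controlled sets exhaust the sequence space up to a null set, a contradiction.\<close>

lemma hausdorff_measure_E_phi_below:
  assumes xi: "\<xi> > 0" and s: "0 < s" "s < tsol \<xi>"
  shows "hausdorff_measure s (E_phi \<xi>) \<noteq> 0"
proof
  assume zero: "hausdorff_measure s (E_phi \<xi>) = 0"
  let ?M = "bern (gibbs \<xi>)"
  interpret prob_space ?M by (rule prob_space_bern)
  define \<epsilon> where "\<epsilon> = (tsol \<xi> - s) * ln 2 / (\<bar>qsol \<xi>\<bar> + 1)"
  have e0: "\<epsilon> > 0" using s by (simp add: \<epsilon>_def)
  have "\<bar>qsol \<xi>\<bar> * \<epsilon> \<le> (\<bar>qsol \<xi>\<bar> + 1) * \<epsilon>" using e0 by simp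
  also have "\<dots> = (tsol \<xi> - s) * ln 2" by (simp add: \<epsilon>_def)
  finally have eps: "\<bar>qsol \<xi>\<bar> * \<epsilon> \<le> (tsol \<xi> - s) * ln 2" .
  obtain N where N: "{x \<in> space ?M. \<not> (\<lambda>n. lnsum n x / real n) \<longlonglongrightarrow> \<xi>} \<subseteq> N" "N \<in> null_sets ?M"
    using gibbs_strong_law[OF xi] unfolding eventually_ae_filter by blast
  let ?C = "\<lambda>K::nat. controlled \<xi> \<epsilon> (real K)"
  have Cm: "?C K \<in> sets ?M" for K
  proof -
    have "{x \<in> space ?M. \<forall>n. \<bar>lnsum n x - real n * \<xi>\<bar> \<le> real n * \<epsilon> + real K} \<in> sets ?M" by measurable
    then show ?thesis by (simp add: controlled_def)
  qed
  have null: "emeasure ?M (?C K) = 0" for K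
  proof -
    define C where "C = 3 * mass_const \<xi> s (real K) * 2 powr s"
    have C: "C > 0" unfolding C_def using mass_const_pos[OF xi s eps] by simp
    have le: "emeasure ?M (?C K) \<le> 0 + ennreal e" if e: "e > 0" for e
    proof -
      have "hausdorff_approx s 1 (E_phi \<xi>) \<le> hausdorff_measure s (E_phi \<xi>)"
        unfolding hausdorff_measure_def by (rule SUP_upper) simp
      then have "hausdorff_approx s 1 (E_phi \<xi>) < ennreal (e / C)" using zero e C by simp
      then obtain U where U: "E_phi \<xi> \<subseteq> (\<Union>i. U i)" "\<And>i. bounded (U i)" "\<And>i. diameter (U i) \<le> 1"
        "(\<Sum>i. ennreal (diameter (U i) powr s)) < ennreal (e / C)"
        unfolding hausdorff_approx_def by (subst (asm) INF_less_iff) auto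
      have "\<exists>B\<in>sets ?M. {x \<in> ?C K. code x \<in> U i} \<subseteq> B \<and> emeasure ?M B \<le> ennreal (C * diameter (U i) powr s)" for i
        unfolding C_def by (rule set_mass[OF xi s eps U(2,3)])
      then have "\<forall>i. \<exists>B. B \<in> sets ?M \<and> {x \<in> ?C K. code x \<in> U i} \<subseteq> B \<and> emeasure ?M B \<le> ennreal (C * diameter (U i) powr s)"
        unfolding Bex_def by (rule allI)
      from choice[OF this] obtain B where B: "\<And>i. B i \<in> sets ?M" "\<And>i. {x \<in> ?C K. code x \<in> U i} \<subseteq> B i"
        "\<And>i. emeasure ?M (B i) \<le> ennreal (C * diameter (U i) powr s)" by blast
      have sub: "?C K \<subseteq> N \<union> (\<Union>i. B i)"
      proof
        fix x assume x: "x \<in> ?C K"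
        show "x \<in> N \<union> (\<Union>i. B i)"
        proof (cases "x \<in> N")
          case False
          then have "code x \<in> E_phi \<xi>" using N(1) by (auto simp: code_mem_E_phi)
          then obtain i where "code x \<in> U i" using U(1) by blast
          then show ?thesis using B(2) x by blast
        qed simp
      qed
      have "emeasure ?M (?C K) \<le> emeasure ?M (N \<union> (\<Union>i. B i))"
        using sub B(1) N(2) by (intro emeasure_mono) auto
      also have "\<dots> \<le> emeasure ?M N + emeasure ?M (\<Union>i. B i)"
        using B(1) N(2) by (intro emeasure_subadditive) auto
      also have "\<dots> = emeasure ?M (\<Union>i. B i)" using N(2) by (simp add: null_sets_def)
      also have "\<dots> \<le> (\<Sum>i. emeasure ?M (B i))" using B(1) by (intro emeasure_subadditive_countably) auto
      also have "\<dots> \<le> (\<Sum>i. ennreal C * ennreal (diameter (U i) powr s))"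
        using B(3) C by (intro suminf_le) (auto simp: ennreal_mult)
      also have "\<dots> = ennreal C * (\<Sum>i. ennreal (diameter (U i) powr s))" by simp
      also have "\<dots> \<le> ennreal C * ennreal (e / C)" using U(4) by (intro mult_left_mono) auto
      also have "\<dots> = ennreal e" using C e by (simp add: ennreal_mult[symmetric])
      finally show ?thesis by simp
    qed
    have "emeasure ?M (?C K) \<le> 0" by (rule ennreal_le_epsilon) (rule le)
    then show ?thesis by simp
  qed
  have "UNIV \<subseteq> N \<union> (\<Union>K. ?C K)"
  proof
    fix x :: "nat \<Rightarrow> nat"
    show "x \<in> N \<union> (\<Union>K. ?C K)"
    proof (cases "x \<in> N")
      case False
      then have "(\<lambda>n. lnsum n x / real n) \<longlonglongrightarrow> \<xi>" using N(1) by auto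
      from tendstoD[OF this e0] obtain n0 where n0: "\<And>n. n \<ge> n0 \<Longrightarrow> \<bar>lnsum n x / real n - \<xi>\<bar> < \<epsilon>"
        by (auto simp: eventually_sequentially dist_real_def)
      \<comment> \<open>The finitely many deviations before the average settles within
        \<open>\<epsilon>\<close> of \<open>\<xi>\<close> are absorbed into the additive
        constant.\<close>
      define R where "R = (\<Sum>n\<le>n0. \<bar>lnsum n x - real n * \<xi>\<bar>)"
      obtain K :: nat where K: "R \<le> real K" using real_arch_simple by blast
      have R0: "R \<ge> 0" unfolding R_def by (intro sum_nonneg) simp
      have "\<bar>lnsum n x - real n * \<xi>\<bar> \<le> real n * \<epsilon> + real K" for n
      proof (cases "n \<le> n0")
        case True
        then have "\<bar>lnsum n x - real n * \<xi>\<bar> \<le> R" unfolding R_def by (intro member_le_sum) auto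
        moreover have "real n * \<epsilon> \<ge> 0" using e0 by simp
        ultimately show ?thesis using K by linarith
      next
        case False
        then have n: "n \<ge> n0" "real n > 0" by auto
        have "\<bar>lnsum n x - real n * \<xi>\<bar> = \<bar>real n * (lnsum n x / real n - \<xi>)\<bar>"
          using n by (simp add: right_diff_distrib)
        also have "\<dots> = real n * \<bar>lnsum n x / real n - \<xi>\<bar>" by (simp add: abs_mult)
        also have "\<dots> \<le> real n * \<epsilon>" using n0[OF n(1)] n(2) by (intro mult_left_mono) auto
        finally show ?thesis using K R0 by linarith
      qed
      then show ?thesis by (auto simp: controlled_def)
    qed simp
  qed
  moreover have "N \<union> (\<Union>K. ?C K) \<in> null_sets ?M"
    using N(2) Cm null by (intro null_sets.Un null_sets_UN) (auto simp: null_sets_def)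
  ultimately have "emeasure ?M UNIV = 0" by (metis null_setsD1 top.extremum_unique)
  then show False using emeasure_space_1 by simp
qed

lemma hausdorff_dim_E_phi:
  assumes "\<xi> > 0"
  shows "hausdorff_dim (E_phi \<xi>) = tsol \<xi>"
  using hausdorff_measure_E_phi_above[OF assms] hausdorff_measure_E_phi_below[OF assms] sol_props(1)[OF assms]
  by (intro hausdorff_dim_eqI) auto

subsection \<open>The typical value \<open>\<xi>\<^sub>0\<close> and the theorem\<close>

lemma has_integral_ceiling_log_piece:
  "((\<lambda>x. ln (real_of_int \<lceil>- log 2 x\<rceil>)) has_integral ln (real (Suc k)) * (1/2) ^ Suc k) {(1/2) ^ Suc k..(1/2) ^ k}"
proof -
  have "((\<lambda>_. ln (real (Suc k))) has_integral ln (real (Suc k)) * (1/2) ^ Suc k) {(1/2 :: real) ^ Suc k..(1/2) ^ k}"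
    using has_integral_const_real[of "ln (real (Suc k))" "(1/2) ^ Suc k" "(1/2) ^ k"]
    by (simp add: mult.commute)
  then show ?thesis
  \<comment> \<open>The ceiling differs from the digit exactly at dyadic points; here only the right
    endpoint, where the ceiling is \<open>k\<close>, has to be discarded.\<close>
  proof (rule has_integral_spike_finite[of "{(1/2) ^ k}", rotated 2])
    fix x :: real assume "x \<in> {(1/2) ^ Suc k..(1/2) ^ k} - {(1/2) ^ k}"
    then have x: "(1/2) ^ Suc k \<le> x" "x < (1/2) ^ k" by auto
    have x0: "x > 0" using x(1) by (rule less_le_trans[rotated]) simp
    have lg: "log 2 ((1/2) ^ n) = - real n" for n :: nat
      by (simp add: log_nat_power log_divide)
    have "- real (Suc k) \<le> log 2 x" unfolding lg[symmetric] using x x0 by (subst log_le_cancel_iff) auto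
    moreover have "log 2 x < - real k" unfolding lg[symmetric] using x x0 by (subst log_less_cancel_iff) auto
    ultimately have "\<lceil>- log 2 x\<rceil> = int (Suc k)" by (intro ceiling_unique) auto
    then show "ln (real_of_int \<lceil>- log 2 x\<rceil>) = ln (real (Suc k))" by simp
  qed simp
qed

text \<open>Lebesgue measure gives the branch of the digit k the mass 2^(-k), so the integral is the
  series for \<open>lnmean 1 0\<close>. The singularity at 0 is handled by monotone convergence
  along [2^(-n), 1].\<close>

lemma xi0_eq: "xi0 = lnmean 1 0"
proof -
  let ?f = "\<lambda>x. ln (real_of_int \<lceil>- log 2 x\<rceil>)"
  let ?s = "\<lambda>n. \<Sum>k<n. ln (real (Suc k)) * (1/2) ^ Suc k"
  let ?g = "\<lambda>n x. if x \<in> {(1/2::real) ^ n..1} then ?f x else 0"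
  have part: "(?f has_integral ?s n) {(1/2) ^ n..1}" for n
  proof (induction n)
    case (Suc n)
    have "(?f has_integral ln (real (Suc n)) * (1/2) ^ Suc n + ?s n) {(1/2) ^ Suc n..1}"
      by (rule has_integral_combine[OF _ _ has_integral_ceiling_log_piece Suc.IH]) (auto intro: power_le_one)
    then show ?case by (simp add: add.commute)
  qed (simp add: has_integral_refl)
  have gs: "(?g n has_integral ?s n) {0..1}" for n
    using part[of n] by (subst has_integral_restrict) auto
  have "summable (\<lambda>k. ln (real (Suc k)) * (1/2) ^ Suc k)"
    using summable_weight[of 1 1 0] by (simp add: weight_1_0)
  then have lim: "?s \<longlonglongrightarrow> lnmean 1 0"
    unfolding lnmean_1_0 by (rule summable_LIMSEQ)
  have mc: "?f integrable_on {0..1} \<and> (\<lambda>n. integral {0..1} (?g n)) \<longlonglongrightarrow> integral {0..1} ?f"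
  proof (rule monotone_convergence_increasing)
    show "?g n integrable_on {0..1}" for n using gs by blast
    show "?g n x \<le> ?g (Suc n) x" if "x \<in> {0..1}" for n x
    proof (cases "x \<in> {(1/2) ^ n..1}")
      case True
      have le: "(1/2::real) ^ Suc n \<le> (1/2) ^ n" by (intro power_decreasing) auto
      have "(1/2) ^ Suc n \<le> x" by (rule order.trans[OF le]) (use True in simp)
      then have "x \<in> {(1/2) ^ Suc n..1}" using True by (simp del: power_Suc)
      then show ?thesis using True by (simp del: power_Suc)
    next
      case False
      have "?f x \<ge> 0"
      proof (cases "x = 0")
        case False
        then have "log 2 x \<le> 0" using that by simp
        then consider "\<lceil>- log 2 x\<rceil> = 0" | "1 \<le> \<lceil>- log 2 x\<rceil>" by linarith
        then show ?thesis
        proof cases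
          case 1
          show ?thesis unfolding 1 by simp
        next
          case 2
          then show ?thesis by (intro ln_ge_zero) (simp only: of_int_1_le_iff)
        qed
      qed (simp add: log_def)
      then show ?thesis using False by auto
    qed
    show "(\<lambda>n. ?g n x) \<longlonglongrightarrow> ?f x" if "x \<in> {0..1}" for x
    proof (cases "x = 0")
      case True
      \<comment> \<open>By the default \<open>ln 0 = 0\<close> the integrand vanishes at the origin,
        in agreement with all the truncations.\<close>
      have z: "?f x = 0" using True by (simp add: log_def)
      have "?g n x = 0" for n by (rule trans[OF if_cong[OF refl z refl]]) simp
      then show ?thesis unfolding z by simp
    next
      case False
      then have "0 < x" using that by auto
      then have "\<forall>\<^sub>F n in sequentially. (1/2::real) ^ n < x"
        by (intro order_tendstoD[OF LIMSEQ_power_zero]) auto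
      then have "\<forall>\<^sub>F n in sequentially. ?g n x = ?f x"
        by eventually_elim (use that in simp)
      then show ?thesis by (rule tendsto_eventually)
    qed
    show "bounded (range (\<lambda>n. integral {0..1} (?g n)))"
      unfolding integral_unique[OF gs] by (rule convergent_imp_bounded[OF lim])
  qed
  then have "?s \<longlonglongrightarrow> xi0" unfolding xi0_def integral_unique[OF gs] by blast
  then show ?thesis using lim LIMSEQ_unique by blast
qed

lemma t_of_deriv:
  assumes "\<xi> > 0"
  shows "(t_of has_real_derivative - qsol \<xi> / lyap (tsol \<xi>) (qsol \<xi>)) (at \<xi>)"
  by (rule has_field_derivative_transform_within_open[OF sol_has_derivative(1)[OF assms], of "{0<..}"])
    (use assms t_of_eq in auto)

lemma deriv_t_of: "\<xi> > 0 \<Longrightarrow> deriv t_of \<xi> = - qsol \<xi> / lyap (tsol \<xi>) (qsol \<xi>)"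
  by (rule DERIV_imp_deriv) (rule t_of_deriv)

lemma t_of_deriv2:
  assumes "\<xi> > 0" "((\<lambda>\<xi>. - qsol \<xi> / lyap (tsol \<xi>) (qsol \<xi>)) has_real_derivative D) (at \<xi>)"
  shows "(deriv t_of has_real_derivative D) (at \<xi>)"
  by (rule has_field_derivative_transform_within_open[OF assms(2), of "{0<..}"])
    (use assms deriv_t_of in auto)

lemma convex_on_pos_cong:
  fixes f g :: "real \<Rightarrow> real"
  assumes "convex_on {0<..} f" "\<And>x. x > 0 \<Longrightarrow> f x = g x"
  shows "convex_on {0<..} g"
proof (rule convex_onI)
  fix t x y :: real assume *: "0 < t" "t < 1" "x \<in> {0<..}" "y \<in> {0<..}"
  then have "(1 - t) *\<^sub>R x + t *\<^sub>R y > 0" by (auto intro!: add_pos_pos)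
  then show "g ((1 - t) *\<^sub>R x + t *\<^sub>R y) \<le> (1 - t) * g x + t * g y"
    using convex_onD[OF assms(1), of t x y] * assms(2) by (metis greaterThan_iff less_imp_le)
qed (rule convex_real_interval)

theorem theorem1p3:
  shows
   "pressure_domain = {(t, q). summable (\<lambda>k. 2 powr (- real (Suc k) * t) * real (Suc k) powr q)}
  \<and> (\<forall>(t, q) \<in> pressure_domain.
        (\<lambda>n. ln (partition_sum n t q) / real n) \<longlonglongrightarrow>
          ln (\<Sum>k. 2 powr (- real (Suc k) * t) * real (Suc k) powr q))
  \<and> (\<forall>\<xi>>0. \<exists>!p. solves_system \<xi> p)
  \<and> hausdorff_dim (E_phi 0) = 0
  \<and> (\<forall>\<xi>>0. hausdorff_dim (E_phi \<xi>) = t_of \<xi>)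
  \<and> t_of xi0 = 1
  \<and> (\<forall>\<xi>. 0 < \<xi> \<and> \<xi> < xi0 \<longrightarrow> (\<exists>D. (t_of has_real_derivative D) (at \<xi>) \<and> D > 0))
  \<and> (t_of has_real_derivative 0) (at xi0)
  \<and> (\<forall>\<xi>>xi0. \<exists>D. (t_of has_real_derivative D) (at \<xi>) \<and> D < 0)
  \<and> (t_of \<longlongrightarrow> 0) (at_right 0)
  \<and> (t_of \<longlongrightarrow> 0) at_top
  \<and> filterlim (deriv t_of) at_top (at_right 0)
  \<and> (\<exists>D. (deriv t_of has_real_derivative D) (at xi0) \<and> D < 0)
  \<and> (\<exists>\<xi>1>xi0. \<exists>D. (deriv t_of has_real_derivative D) (at \<xi>1) \<and> D > 0)
  \<and> \<not> convex_on {0<..} t_of \<and> \<not> concave_on {0<..} t_of"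
proof (intro conjI)
  have weight_fun: "weight t q = (\<lambda>k. 2 powr (- real (Suc k) * t) * real (Suc k) powr q)" for t q
    by (simp add: weight_def fun_eq_iff)
  have x0: "xi0 > 0" by (simp add: xi0_eq lnmean_pos)
  have lp: "lyap (tsol \<xi>) (qsol \<xi>) > 0" if "\<xi> > 0" for \<xi>
    using lyap_pos sol_props(1) that by blast
  have ev0: "\<forall>\<^sub>F \<xi> in at_right 0. (\<xi>::real) > 0" by (simp add: eventually_at_right_less)
  show "pressure_domain = {(t, q). summable (\<lambda>k. 2 powr (- real (Suc k) * t) * real (Suc k) powr q)}"
    using pressure_domain_eq unfolding weight_fun .
  show "\<forall>(t, q) \<in> pressure_domain. (\<lambda>n. ln (partition_sum n t q) / real n) \<longlonglongrightarrow>
          ln (\<Sum>k. 2 powr (- real (Suc k) * t) * real (Suc k) powr q)"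
  proof clarify
    fix t q assume "(t, q) \<in> pressure_domain"
    then have "summable (weight t q)" by (simp add: pressure_domain_eq)
    from partition_sum_tendsto[OF this]
    show "(\<lambda>n. ln (partition_sum n t q) / real n) \<longlonglongrightarrow>
          ln (\<Sum>k. 2 powr (- real (Suc k) * t) * real (Suc k) powr q)"
      unfolding press_def wsum_0_eq weight_fun .
  qed
  show "\<forall>\<xi>>0. \<exists>!p. solves_system \<xi> p"
    using is_sol_exists is_sol_unique by (auto simp: solves_system_iff)
  show "hausdorff_dim (E_phi 0) = 0" by (rule hausdorff_dim_E_phi_0)
  show "\<forall>\<xi>>0. hausdorff_dim (E_phi \<xi>) = t_of \<xi>" by (simp add: hausdorff_dim_E_phi t_of_eq)
  show "t_of xi0 = 1" using x0 by (simp add: t_of_eq xi0_eq sol_lnmean_1_0)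
  show "\<forall>\<xi>. 0 < \<xi> \<and> \<xi> < xi0 \<longrightarrow> (\<exists>D. (t_of has_real_derivative D) (at \<xi>) \<and> D > 0)"
  proof (intro allI impI exI conjI)
    fix \<xi> :: real assume "0 < \<xi> \<and> \<xi> < xi0"
    then show "(t_of has_real_derivative - qsol \<xi> / lyap (tsol \<xi>) (qsol \<xi>)) (at \<xi>)"
      "- qsol \<xi> / lyap (tsol \<xi>) (qsol \<xi>) > 0"
      using t_of_deriv qsol_neg[of \<xi>] lp[of \<xi>] by (auto simp: xi0_eq divide_neg_pos)
  qed
  show "(t_of has_real_derivative 0) (at xi0)"
    using t_of_deriv[OF x0] by (simp add: xi0_eq sol_lnmean_1_0)
  show "\<forall>\<xi>>xi0. \<exists>D. (t_of has_real_derivative D) (at \<xi>) \<and> D < 0"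
  proof (intro allI impI exI conjI)
    fix \<xi> :: real assume xi: "xi0 < \<xi>"
    then show "(t_of has_real_derivative - qsol \<xi> / lyap (tsol \<xi>) (qsol \<xi>)) (at \<xi>)"
      using x0 by (intro t_of_deriv) simp
    show "- qsol \<xi> / lyap (tsol \<xi>) (qsol \<xi>) < 0"
      using xi x0 qsol_pos[of \<xi>] lp[of \<xi>] by (simp add: xi0_eq)
  qed
  show "(t_of \<longlongrightarrow> 0) (at_right 0)"
  proof (rule Lim_transform_eventually[OF tsol_tendsto_0_at_0])
    show "\<forall>\<^sub>F \<xi> in at_right 0. tsol \<xi> = t_of \<xi>" using ev0 by eventually_elim (simp add: t_of_eq)
  qed
  show "(t_of \<longlongrightarrow> 0) at_top"
  proof (rule Lim_transform_eventually[OF tsol_tendsto_0_at_top])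
    show "\<forall>\<^sub>F \<xi> in at_top. tsol \<xi> = t_of \<xi>"
      using eventually_gt_at_top[of "0 :: real"] by eventually_elim (simp add: t_of_eq)
  qed
  have "\<forall>\<^sub>F \<xi> in at_right 0. deriv t_of \<xi> = - qsol \<xi> / lyap (tsol \<xi>) (qsol \<xi>)"
    using ev0 by eventually_elim (rule deriv_t_of)
  then show "filterlim (deriv t_of) at_top (at_right 0)"
    using slope_at_top by (subst filterlim_cong[OF refl refl]) 
  show "\<exists>D. (deriv t_of has_real_derivative D) (at xi0) \<and> D < 0"
    using slope_deriv_xi0 t_of_deriv2[OF x0] unfolding xi0_eq by blast
  show "\<exists>\<xi>1>xi0. \<exists>D. (deriv t_of has_real_derivative D) (at \<xi>1) \<and> D > 0"
  proof -
    obtain \<xi>1 D where "\<xi>1 > xi0" "D > 0" "((\<lambda>\<xi>. - qsol \<xi> / lyap (tsol \<xi>) (qsol \<xi>)) has_real_derivative D) (at \<xi>1)"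
      using slope_deriv_pos_exists unfolding xi0_eq by blast
    moreover from this have "(deriv t_of has_real_derivative D) (at \<xi>1)"
      using x0 by (intro t_of_deriv2) auto
    ultimately show ?thesis by blast
  qed
  have "convex_on {0<..} t_of = convex_on {0<..} tsol" "concave_on {0<..} t_of = concave_on {0<..} tsol"
    unfolding concave_on_def by (auto elim!: convex_on_pos_cong simp: t_of_eq)
  then show "\<not> convex_on {0<..} t_of" "\<not> concave_on {0<..} t_of"
    using tsol_not_convex tsol_not_concave by auto
qed

end
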